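(* Let $A\in L^1_{\mathrm{loc}}(\mathbb{R})^{d\times d}$ be such that the propagator of $y'=A(x)y$ is exponentially bounded on $\mathbb{R}$ and such that $y'=A(x)y$ has an exponential dichotomy $Q\neq I_d$ on $\mathbb{R}$. Let $R\in L^1_{\mathrm{loc}}(\mathbb{R})^{d\times d}$ satisfy $$\|R\|_{\mathbb{C}^{d\times d}}\in L^1(\mathbb{R}_-;e^{\beta|x|}dx)\quad\text{for some }\beta>\varkappa_-(I_d-Q)-\lambda_-'(I_d-Q).$$ Then the perturbed equation $y'(x)=(A(x)+R(x))y(x)$ has a unique matrix-valued Jost solution $Y_-(x)$, $x\le0$; that is, there is a unique $d\times d$ matrix-valued solution $Y_-$ of $Y_-'(x)=(A(x)+R(x))Y_-(x)$ on $\mathbb{R}_-$ with $$\liminf_{x\to-\infty}\frac{\log\|Y_-(x)-\Phi(x)(I_d-Q)\|_{\mathbb{C}^{d\times d}}}{x}>\varkappa_-(I_d-Q).$$ Moreover, the map $R\mapsto Y_-(0)$ from $L^1(\mathbb{R}_-;e^{\beta|x|}dx)^{d\times d}$ to $\mathbb{C}^{d\times d}$ is continuous.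
   Context: $\mathbb{R}_-=(-\infty,0]$; $\log 0=-\infty$. $\Phi$ is the fundamental matrix solution: $\Phi'=A\Phi$ a.e. on $\mathbb{R}$, $\Phi(0)=I_d$. The propagator is exponentially bounded on $\mathbb{R}$ if $\sup_{|x-x'|\le1}\|\Phi(x)\Phi(x')^{-1}\|<\infty$. A projection $Q$ in $\mathbb{C}^d$ is an exponential dichotomy on $\mathbb{R}$ if there are constants $\varkappa,\varkappa'>0$ and $C,C'\ge1$ with $\|\Phi(x)Q\Phi(x')^{-1}\|\le Ce^{-\varkappa(x-x')}$ for $x\ge x'$ and $\|\Phi(x)(I_d-Q)\Phi(x')^{-1}\|\le C'e^{\varkappa'(x-x')}$ for $x\le x'$, $x,x'\in\mathbb{R}$. For a projection $P$ with $\sup_{x}\|\Phi(x)P\Phi(x)^{-1}\|<\infty$, the upper Bohl exponent on $\mathbb{R}_-$, $\varkappa_-(P)$, is the infimum of all $\varkappa\in\mathbb{R}$ for which there is a constant $C(\varkappa)$ with $\|\Phi(x)P\Phi(x')^{-1}\|\le C(\varkappa)e^{\varkappa(x-x')}$ for all $x'\le x\le0$. The lower Lyapunov exponent on $\mathbb{R}_-$ is $\lambda_-'(P)=-\limsup_{x\to-\infty}|x|^{-1}\log\|\Phi(x)P\|$. *)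

theory Defs
  imports "HOL-Analysis.Analysis"
begin

text \<open>Throughout, matrices carry the library norm of \<^typ>\<open>complex^'d^'d\<close>, i.e. the Frobenius norm;
  all notions below are unaffected by passing to an equivalent norm.\<close>

text \<open>The intervals of a division are compact, nonempty and non-overlapping, so \<^term>\<open>Inf k\<close>
  and \<^term>\<open>Sup k\<close> are the end points of \<^term>\<open>k\<close>.\<close>

definition absolutely_continuous_fun_on :: "real set \<Rightarrow> (real \<Rightarrow> 'a::real_normed_vector) \<Rightarrow> bool"
  where "absolutely_continuous_fun_on S f \<longleftrightarrow>
    (\<forall>e>0. \<exists>\<delta>>0. \<forall>d t. d division_of t \<and> t \<subseteq> S \<and> (\<Sum>k\<in>d. Sup k - Inf k) < \<delta> \<longrightarrow>
       (\<Sum>k\<in>d. norm (f (Sup k) - f (Inf k))) < e)"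

definition locally_integrable :: "(real \<Rightarrow> 'a::euclidean_space) \<Rightarrow> bool"
  where "locally_integrable f \<longleftrightarrow> (\<forall>a b. f absolutely_integrable_on {a..b})"

text \<open>Caratheodory solutions of \<open>Y' = M(x) Y\<close> on the interval \<open>S\<close>: locally absolutely
  continuous functions satisfying the equation almost everywhere.\<close>

definition matrix_ode_solution ::
    "(real \<Rightarrow> complex^'d^'d) \<Rightarrow> real set \<Rightarrow> (real \<Rightarrow> complex^'d^'d) \<Rightarrow> bool"
  where "matrix_ode_solution M S Y \<longleftrightarrow>
    (\<forall>a b. {a..b} \<subseteq> S \<longrightarrow> absolutely_continuous_fun_on {a..b} Y) \<and>
    (AE x in lebesgue. x \<in> S \<longrightarrow> (Y has_vector_derivative M x ** Y x) (at x within S))"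

definition fundamental_matrix_solution ::
    "(real \<Rightarrow> complex^'d^'d) \<Rightarrow> (real \<Rightarrow> complex^'d^'d) \<Rightarrow> bool"
  where "fundamental_matrix_solution A \<Phi> \<longleftrightarrow> matrix_ode_solution A UNIV \<Phi> \<and> \<Phi> 0 = mat 1"

definition propagator_exponentially_bounded :: "(real \<Rightarrow> complex^'d^'d) \<Rightarrow> bool"
  where "propagator_exponentially_bounded \<Phi> \<longleftrightarrow>
    (\<exists>K. \<forall>x x'. \<bar>x - x'\<bar> \<le> 1 \<longrightarrow> norm (\<Phi> x ** matrix_inv (\<Phi> x')) \<le> K)"

text \<open>Projections are not required to be orthogonal.\<close>

definition matrix_projection :: "complex^'d^'d \<Rightarrow> bool"
  where "matrix_projection P \<longleftrightarrow> P ** P = P"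

definition exponential_dichotomy :: "(real \<Rightarrow> complex^'d^'d) \<Rightarrow> complex^'d^'d \<Rightarrow> bool"
  where "exponential_dichotomy \<Phi> Q \<longleftrightarrow> matrix_projection Q \<and>
    (\<exists>\<kappa>>0. \<exists>\<kappa>'>0. \<exists>C\<ge>1. \<exists>C'\<ge>1.
       (\<forall>x x'. x \<ge> x' \<longrightarrow>
          norm (\<Phi> x ** Q ** matrix_inv (\<Phi> x')) \<le> C * exp (- \<kappa> * (x - x'))) \<and>
       (\<forall>x x'. x \<le> x' \<longrightarrow>
          norm (\<Phi> x ** (mat 1 - Q) ** matrix_inv (\<Phi> x')) \<le> C' * exp (\<kappa>' * (x - x'))))"

text \<open>Logarithm on \<open>[0, \<infinity>)\<close> with \<open>log 0 = -\<infinity>\<close>.\<close>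

definition elog :: "real \<Rightarrow> ereal"
  where "elog r = (if r = 0 then - \<infinity> else ereal (ln r))"

text \<open>The exponents are meant for projections \<open>P\<close> with
  \<open>sup\<^sub>x norm (\<Phi> x ** P ** matrix_inv (\<Phi> x)) < \<infinity>\<close>. They are extended reals; the infimum
  of the empty set is \<open>\<infinity>\<close>.\<close>

definition upper_bohl_minus :: "(real \<Rightarrow> complex^'d^'d) \<Rightarrow> complex^'d^'d \<Rightarrow> ereal"
  where "upper_bohl_minus \<Phi> P =
    Inf (ereal ` {\<kappa>. \<exists>C. \<forall>x x'. x' \<le> x \<and> x \<le> 0 \<longrightarrow>
      norm (\<Phi> x ** P ** matrix_inv (\<Phi> x')) \<le> C * exp (\<kappa> * (x - x'))})"

definition lower_lyapunov_minus :: "(real \<Rightarrow> complex^'d^'d) \<Rightarrow> complex^'d^'d \<Rightarrow> ereal"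
  where "lower_lyapunov_minus \<Phi> P =
    - Limsup at_bot (\<lambda>x. elog (norm (\<Phi> x ** P)) / ereal \<bar>x\<bar>)"

text \<open>The space \<open>L\<^sup>1((-\<infinity>,0]; exp(\<beta>|x|) dx)\<close> of matrix functions, represented by functions on
  the whole line whose values on \<open>(0,\<infinity>)\<close> are irrelevant; its elements are not
  identified almost everywhere, so \<open>weighted_L1_norm\<close> is a seminorm.\<close>

definition weighted_L1 :: "real \<Rightarrow> (real \<Rightarrow> complex^'d^'d) set"
  where "weighted_L1 \<beta> = {R. (\<lambda>x. exp (\<beta> * \<bar>x\<bar>) *\<^sub>R R x) absolutely_integrable_on {..0}}"

definition weighted_L1_norm :: "real \<Rightarrow> (real \<Rightarrow> complex^'d^'d) \<Rightarrow> real"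
  where "weighted_L1_norm \<beta> R = (LINT x:{..0}|lebesgue. norm (R x) * exp (\<beta> * \<bar>x\<bar>))"

definition weighted_L1_continuous ::
    "real \<Rightarrow> ((real \<Rightarrow> complex^'d^'d) \<Rightarrow> complex^'d^'d) \<Rightarrow> bool"
  where "weighted_L1_continuous \<beta> F \<longleftrightarrow>
    (\<forall>R\<in>weighted_L1 \<beta>. \<forall>e>0. \<exists>\<delta>>0. \<forall>R'\<in>weighted_L1 \<beta>.
       weighted_L1_norm \<beta> (\<lambda>x. R' x - R x) < \<delta> \<longrightarrow> norm (F R' - F R) < e)"

text \<open>A function on \<open>(-\<infinity>,0]\<close> is represented by its extensional version
  (\<^const>\<open>undefined\<close> on \<open>(0,\<infinity>)\<close>), so that equality means equality on \<open>(-\<infinity>,0]\<close>.\<close>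

definition jost_solution_minus ::
    "(real \<Rightarrow> complex^'d^'d) \<Rightarrow> (real \<Rightarrow> complex^'d^'d) \<Rightarrow> complex^'d^'d \<Rightarrow>
     (real \<Rightarrow> complex^'d^'d) \<Rightarrow> (real \<Rightarrow> complex^'d^'d) \<Rightarrow> bool"
  where "jost_solution_minus A \<Phi> Q R Y \<longleftrightarrow>
    Y \<in> extensional {..0} \<and>
    matrix_ode_solution (\<lambda>x. A x + R x) {..0} Y \<and>
    Liminf at_bot (\<lambda>x. elog (norm (Y x - \<Phi> x ** (mat 1 - Q))) / ereal x)
      > upper_bohl_minus \<Phi> (mat 1 - Q)"

definition the_jost_minus ::
    "(real \<Rightarrow> complex^'d^'d) \<Rightarrow> (real \<Rightarrow> complex^'d^'d) \<Rightarrow> complex^'d^'d \<Rightarrow>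
     (real \<Rightarrow> complex^'d^'d) \<Rightarrow> real \<Rightarrow> complex^'d^'d"
  where "the_jost_minus A \<Phi> Q R = (THE Y. jost_solution_minus A \<Phi> Q R Y)"

end

(*
The fundamental solution propagates forward along the negative half-line with
|Phi(x) Phi(t)^-1| <= C exp(kappa (x - t)) for every kappa above the upper Bohl exponent of I - Q: on the
range of I - Q this is the definition of that exponent, on the range of Q the propagator even decays, and
the exponent is positive because I - Q decays at minus infinity without vanishing. Hence the Jost solution solves the
Volterra equation
  Y(x) = Phi(x) (I - Q) + Phi(x) int_{-oo}^x Phi(t)^-1 R(t) Y(t) dt,
which, after division by exp(kappa x), has a bounded kernel dominated by the integrable function |R|. With
m(x) = int_{-oo}^x |R|, the integral operator is a contraction for the weight exp(2 C m(x)), because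
int_{-oo}^x |R| exp(L m) <= exp(L m(x)) / L. The same estimate yields a Gronwall inequality on the
half-line, which gives uniqueness and the continuous dependence of Y(0) on R.
*)
theory Submission
  imports Defs
begin

section \<open>Absolute continuity and the fundamental theorem of calculus\<close>

text \<open>The weight pays for one thing only. Division by exp(\<kappa> x) makes the kernel
  bounded, but may let the free solution \<Phi> P grow up to exp((\<kappa> - \<mu>)|x|), where \<mu>
  is a rate below the lower Lyapunov exponent. So the fixed point is sought not for Y but for Y -
  \<Phi> P divided by exp(\<kappa> x): its kernel sees |R| alone, and its inhomogeneity, built from
  the integral of Phi^-1 R Phi P, is bounded by the weighted norm of R because \<kappa> - \<mu>
  \<le> \<beta>. The strict inequality for \<beta> leaves room to take \<kappa> strictly above the
  Bohl exponent and \<mu> strictly below the Lyapunov exponent, before R is given; hence the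
  constants in the continuity estimate are common to all R. Uniqueness cannot rely on this \<kappa>:
  a competitor approaches \<Phi> P at some rate above the Bohl exponent that may lie below \<kappa>,
  so another \<kappa> is chosen for each pair of solutions. As A and R are merely integrable,
  calculus is done with absolutely continuous functions, starting from the fundamental theorem for
  them.\<close>

lemma absolutely_continuous_fun_on_subset:
  "absolutely_continuous_fun_on S f \<Longrightarrow> T \<subseteq> S \<Longrightarrow> absolutely_continuous_fun_on T f"
  unfolding absolutely_continuous_fun_on_def
  by (elim all_forward imp_forward ex_forward conj_forward) auto

lemma absolutely_continuous_fun_onE:
  assumes "absolutely_continuous_fun_on S f" "e > 0"
  obtains \<delta> where "\<delta> > 0"
    "\<forall>d t. d division_of t \<and> t \<subseteq> S \<and> (\<Sum>k\<in>d. Sup k - Inf k) < \<delta> \<longrightarrow>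
       (\<Sum>k\<in>d. norm (f (Sup k) - f (Inf k))) < e"
  using assms(1)[unfolded absolutely_continuous_fun_on_def, rule_format, OF assms(2)]
  by (elim exE conjE)

lemma division_real_cases:
  fixes d :: "real set set"
  assumes "d division_of t" "k \<in> d"
  obtains u v where "k = {u..v}" "u \<le> v" "u \<in> t" "v \<in> t"
proof -
  obtain u v where k: "k = cbox u v" using division_ofD(4)[OF assms] by blast
  moreover have "k \<noteq> {}" "k \<subseteq> t" using division_ofD(2,3)[OF assms] by auto
  ultimately show ?thesis using that[of u v] by (auto simp: subset_iff)
qed

text \<open>The common source of absolute continuity for products, differences, inverses and
  \<open>exp (L * m)\<close>. Two dominating functions, because a product needs both its factors;
  \<open>g = h\<close> when there is only one.\<close>

lemma absolutely_continuous_fun_on_dominated: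
  assumes g: "absolutely_continuous_fun_on S g" and h: "absolutely_continuous_fun_on S h"
    and le: "\<And>x y. x \<in> S \<Longrightarrow> y \<in> S \<Longrightarrow> norm (f y - f x) \<le> K * (norm (g y - g x) + norm (h y - h x))"
  shows "absolutely_continuous_fun_on S f"
  unfolding absolutely_continuous_fun_on_def
proof (intro allI impI)
  fix e :: real assume "e > 0"
  \<comment> \<open>\<open>K\<close> may be negative or 0: the bound uses
    \<open>\<bar>K\<bar>\<close>, and the added 1 avoids division by 0 and keeps the last inequality
    strict.\<close>
  define e' where "e' = e / (\<bar>K\<bar> + 1) / 2"
  have "e' > 0" using \<open>e > 0\<close> by (auto simp: e'_def)
  obtain \<delta>1 where 1: "\<delta>1 > 0" "\<forall>d t. d division_of t \<and> t \<subseteq> S \<and> (\<Sum>k\<in>d. Sup k - Inf k) < \<delta>1 \<longrightarrow>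
       (\<Sum>k\<in>d. norm (g (Sup k) - g (Inf k))) < e'"
    by (rule absolutely_continuous_fun_onE[OF g \<open>e' > 0\<close>])
  obtain \<delta>2 where 2: "\<delta>2 > 0" "\<forall>d t. d division_of t \<and> t \<subseteq> S \<and> (\<Sum>k\<in>d. Sup k - Inf k) < \<delta>2 \<longrightarrow>
       (\<Sum>k\<in>d. norm (h (Sup k) - h (Inf k))) < e'"
    by (rule absolutely_continuous_fun_onE[OF h \<open>e' > 0\<close>])
  show "\<exists>\<delta>>0. \<forall>d t. d division_of t \<and> t \<subseteq> S \<and> (\<Sum>k\<in>d. Sup k - Inf k) < \<delta> \<longrightarrow>
       (\<Sum>k\<in>d. norm (f (Sup k) - f (Inf k))) < e"
  proof (intro exI[of _ "min \<delta>1 \<delta>2"] conjI allI impI)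
    fix d t
    assume a: "d division_of t \<and> t \<subseteq> S \<and> (\<Sum>k\<in>d. Sup k - Inf k) < min \<delta>1 \<delta>2"
    have "(\<Sum>k\<in>d. norm (f (Sup k) - f (Inf k)))
        \<le> (\<Sum>k\<in>d. \<bar>K\<bar> * (norm (g (Sup k) - g (Inf k)) + norm (h (Sup k) - h (Inf k))))"
    proof (rule sum_mono)
      fix k assume "k \<in> d"
      then obtain u v where k: "k = {u..v}" "u \<le> v" "u \<in> t" "v \<in> t"
        using a division_real_cases by metis
      have "norm (f v - f u) \<le> K * (norm (g v - g u) + norm (h v - h u))"
        using le[of u v] k a by auto
      also have "\<dots> \<le> \<bar>K\<bar> * (norm (g v - g u) + norm (h v - h u))"
        by (intro mult_right_mono) auto
      finally show "norm (f (Sup k) - f (Inf k)) \<le> \<bar>K\<bar> * (norm (g (Sup k) - g (Inf k)) + norm (h (Sup k) - h (Inf k)))"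
        using k by simp
    qed
    also have "\<dots> = \<bar>K\<bar> * ((\<Sum>k\<in>d. norm (g (Sup k) - g (Inf k))) + (\<Sum>k\<in>d. norm (h (Sup k) - h (Inf k))))"
      by (simp flip: sum_distrib_left sum.distrib)
    also have "\<dots> \<le> \<bar>K\<bar> * (e' + e')"
      using 1(2)[rule_format, of d t] 2(2)[rule_format, of d t] a by (intro mult_left_mono) auto
    also have "e' + e' = e / (\<bar>K\<bar> + 1)" unfolding e'_def by (rule field_sum_of_halves)
    also have "\<bar>K\<bar> * (e / (\<bar>K\<bar> + 1)) < e" using \<open>e > 0\<close> by (simp add: pos_divide_less_eq)
    finally show "(\<Sum>k\<in>d. norm (f (Sup k) - f (Inf k))) < e" .
  qed (use 1 2 in auto)
qed

lemma absolutely_continuous_fun_on_imp_continuous_on: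
  assumes f: "absolutely_continuous_fun_on S f" and S: "is_interval S"
  shows "continuous_on S f"
  unfolding continuous_on_iff
proof (intro ballI allI impI)
  fix x e :: real assume "x \<in> S" "e > 0"
  obtain \<delta> where d: "\<delta> > 0" "\<forall>d t. d division_of t \<and> t \<subseteq> S \<and> (\<Sum>k\<in>d. Sup k - Inf k) < \<delta> \<longrightarrow>
       (\<Sum>k\<in>d. norm (f (Sup k) - f (Inf k))) < e"
    by (rule absolutely_continuous_fun_onE[OF f \<open>e > 0\<close>])
  have *: "norm (f v - f u) < e" if "u \<le> v" "u \<in> S" "v \<in> S" "v - u < \<delta>" for u v
  proof -
    have "{u..v} \<subseteq> S" using mem_is_interval_1_I[OF S that(2,3)] by auto
    moreover have "{{u..v}} division_of {u..v}"
      using division_of_self[of u v] that by simp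
    ultimately show ?thesis using d(2)[rule_format, of "{{u..v}}" "{u..v}"] that by simp
  qed
  show "\<exists>d>0. \<forall>x'\<in>S. dist x' x < d \<longrightarrow> dist (f x') (f x) < e"
  proof (intro exI[of _ \<delta>] conjI ballI impI)
    fix x' assume "x' \<in> S" "dist x' x < \<delta>"
    then show "dist (f x') (f x) < e"
      using *[of x x'] *[of x' x] \<open>x \<in> S\<close>
      by (cases "x \<le> x'") (auto simp: dist_norm norm_minus_commute)
  qed (use d in auto)
qed

text \<open>The gauge keeps the cells tagged in the exceptional set inside an open set of small measure, where
  absolute continuity makes the increments of \<open>f\<close> small; the other cells are handled by
  differentiability at their tag.\<close>

lemma fundamental_theorem_of_calculus_absolutely_continuous:
  fixes f :: "real \<Rightarrow> 'a::euclidean_space"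
  assumes ab: "a \<le> b" and ac: "absolutely_continuous_fun_on {a..b} f" and N: "negligible N"
    and der: "\<And>x. x \<in> {a..b} - N \<Longrightarrow> (f has_vector_derivative g x) (at x within {a..b})"
  shows "(g has_integral f b - f a) {a..b}"
proof -
  \<comment> \<open>The values of \<open>g\<close> on \<open>N\<close> are uncontrolled. With 0 in
    their place, the cells tagged in \<open>N\<close> contribute only increments of
    \<open>f\<close>; passing back to \<open>g\<close> changes \<open>h\<close> on a negligible
    set.\<close>
  define h where "h = (\<lambda>x. if x \<in> N then 0 else g x)"
  have "(h has_integral f b - f a) {a..b}"
    unfolding has_integral_real
  proof (intro allI impI)
    fix e :: real assume "e > 0"
    \<comment> \<open>The regular cells together contribute at most \<open>\<eta> * (b - a)\<close>;
      the added 1 covers \<open>a = b\<close>.\<close>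
    define \<eta> where "\<eta> = e / (2 * (b - a + 1))"
    have \<eta>: "\<eta> > 0" "\<eta> * (b - a) < e / 2" using ab \<open>e > 0\<close> by (auto simp: \<eta>_def field_simps)
    have "\<exists>d>0. \<forall>y\<in>{a..b}. \<bar>y - x\<bar> < d \<longrightarrow> norm (f y - f x - (y - x) *\<^sub>R g x) \<le> \<eta> * \<bar>y - x\<bar>"
      if "x \<in> {a..b} - N" for x
      using der[OF that] \<eta>(1)
      unfolding has_vector_derivative_def has_derivative_within_alt by auto
    then obtain D where D: "\<And>x. x \<in> {a..b} - N \<Longrightarrow> D x > 0"
      "\<And>x y. x \<in> {a..b} - N \<Longrightarrow> y \<in> {a..b} \<Longrightarrow> \<bar>y - x\<bar> < D x \<Longrightarrow>
        norm (f y - f x - (y - x) *\<^sub>R g x) \<le> \<eta> * \<bar>y - x\<bar>" by metis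
    obtain \<delta> where d: "\<delta> > 0" "\<forall>d t. d division_of t \<and> t \<subseteq> {a..b} \<and> (\<Sum>k\<in>d. Sup k - Inf k) < \<delta> \<longrightarrow>
       (\<Sum>k\<in>d. norm (f (Sup k) - f (Inf k))) < e / 2"
      by (rule absolutely_continuous_fun_onE[OF ac half_gt_zero[OF \<open>e > 0\<close>]])
    \<comment> \<open>Non-overlapping cells inside \<open>U\<close> have total length below
      \<open>\<delta>\<close>, which is what absolute continuity asks for.\<close>
    obtain U where U: "open U" "N \<subseteq> U" "U - N \<in> lmeasurable" "emeasure lebesgue (U - N) < ennreal \<delta>"
      using sets_lebesgue_outer_open[OF negligible_imp_sets[OF N] d(1)] by metis
    have Um: "U \<in> lmeasurable" "measure lebesgue U < \<delta>"
    proof -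
      have "N \<in> lmeasurable" "measure lebesgue N = 0"
        using N by (auto simp: negligible_imp_measurable negligible_imp_measure0)
      moreover have eq: "U = (U - N) \<union> N" using U(2) by auto
      moreover have "measure lebesgue (U - N) < \<delta>"
        using U(3,4) d(1) by (simp add: emeasure_eq_measure2 fmeasurableD2 ennreal_less_iff)
      ultimately show "U \<in> lmeasurable" using fmeasurable.Un[OF U(3)] by metis
      have "measure lebesgue U \<le> measure lebesgue (U - N) + measure lebesgue N"
        using eq measure_Un_le[of "U - N" lebesgue N] U(3) \<open>N \<in> lmeasurable\<close> by (metis fmeasurableD)
      then show "measure lebesgue U < \<delta>"
        using \<open>measure lebesgue N = 0\<close> \<open>measure lebesgue (U - N) < \<delta>\<close> by simp
    qed
    define \<gamma> where "\<gamma> = (\<lambda>x. if x \<in> N then U else if x \<in> {a..b} then ball x (D x) else ball x 1)"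
    show "\<exists>\<gamma>. gauge \<gamma> \<and> (\<forall>\<D>. \<D> tagged_division_of {a..b} \<and> \<gamma> fine \<D> \<longrightarrow>
            norm ((\<Sum>(x, k)\<in>\<D>. measure lborel k *\<^sub>R h x) - (f b - f a)) < e)"
    proof (intro exI[of _ \<gamma>] conjI allI impI)
      show "gauge \<gamma>" using U D(1) by (auto simp: gauge_def \<gamma>_def)
      fix p assume p: "p tagged_division_of {a..b} \<and> \<gamma> fine p"
      note p' = tagged_division_ofD[OF conjunct1[OF p]]
      have fin: "finite p" using p' by blast
      define p1 where "p1 = {z \<in> p. fst z \<in> N}"
      have split: "p = p1 \<union> (p - p1)" "p1 \<inter> (p - p1) = {}" by (auto simp: p1_def)
      have k_cases: "\<exists>u v. k = {u..v} \<and> u \<le> x \<and> x \<le> v \<and> u \<in> {a..b} \<and> v \<in> {a..b} \<and> x \<in> {a..b} \<and> {u..v} \<subseteq> \<gamma> x"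
        if xk: "(x, k) \<in> p" for x k
      proof -
        obtain u v where "k = cbox u v" using p'(4)[OF xk] by (elim exE)
        moreover have "x \<in> k" "k \<subseteq> {a..b}" by (fact p'(2)[OF xk], fact p'(3)[OF xk])
        moreover have "k \<subseteq> \<gamma> x" using fineD[OF conjunct2[OF p] xk] .
        ultimately show ?thesis by (intro exI[of _ u] exI[of _ v]) (simp add: subset_iff)
      qed
      define F where "F = (\<lambda>k::real set. f (Sup k) - f (Inf k))"
      have "(\<Sum>(x, k)\<in>p. measure lborel k *\<^sub>R h x) - (f b - f a) = (\<Sum>(x, k)\<in>p. measure lborel k *\<^sub>R h x - F k)"
        using additive_tagged_division_1[OF ab conjunct1[OF p], of f]
        by (simp add: sum_subtractf case_prod_unfold F_def)
      also have "norm \<dots> \<le> (\<Sum>(x, k)\<in>p. norm (measure lborel k *\<^sub>R h x - F k))"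
        by (rule order_trans[OF norm_sum]) (simp add: case_prod_unfold)
      also have "\<dots> = (\<Sum>(x, k)\<in>p1. norm (measure lborel k *\<^sub>R h x - F k)) + (\<Sum>(x, k)\<in>p - p1. norm (measure lborel k *\<^sub>R h x - F k))"
        using fin split by (metis (no_types, lifting) finite_Un sum.union_disjoint)
      also have "\<dots> < e"
      proof -
        have "(\<Sum>(x, k)\<in>p - p1. norm (measure lborel k *\<^sub>R h x - F k)) \<le> (\<Sum>(x, k)\<in>p - p1. \<eta> * measure lborel k)"
        proof (rule sum_mono, clarify)
          fix x k assume xk: "(x, k) \<in> p" "(x, k) \<notin> p1"
          then obtain u v where uv: "k = {u..v}" "u \<le> x" "x \<le> v" "u \<in> {a..b}" "v \<in> {a..b}" "x \<in> {a..b}" "{u..v} \<subseteq> \<gamma> x"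
            using k_cases by metis
          have "x \<notin> N" using xk by (auto simp: p1_def)
          then have "{u..v} \<subseteq> ball x (D x)" using uv by (simp add: \<gamma>_def)
          then have "u \<in> ball x (D x)" "v \<in> ball x (D x)" using uv(2,3) by (simp_all add: subset_iff del: mem_ball)
          then have "\<bar>u - x\<bar> < D x" "\<bar>v - x\<bar> < D x" by (auto simp: dist_real_def)
          then have 1: "norm (f u - f x - (u - x) *\<^sub>R g x) \<le> \<eta> * \<bar>u - x\<bar>"
            and 2: "norm (f v - f x - (v - x) *\<^sub>R g x) \<le> \<eta> * \<bar>v - x\<bar>"
            using D(2)[of x u] D(2)[of x v] uv \<open>x \<notin> N\<close> by auto
          \<comment> \<open>The increment over the cell is split at the tag \<open>x\<close>, since
            differentiability at \<open>x\<close> compares only with \<open>f x\<close>.\<close>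
          have "measure lborel k *\<^sub>R h x - F k = (f u - f x - (u - x) *\<^sub>R g x) - (f v - f x - (v - x) *\<^sub>R g x)"
            using uv \<open>x \<notin> N\<close> by (simp add: F_def h_def algebra_simps)
          then have "norm (measure lborel k *\<^sub>R h x - F k) \<le> \<eta> * \<bar>u - x\<bar> + \<eta> * \<bar>v - x\<bar>"
            using norm_triangle_ineq4[of "f u - f x - (u - x) *\<^sub>R g x" "f v - f x - (v - x) *\<^sub>R g x"] 1 2
            by (smt (verit))
          also have "\<dots> = \<eta> * measure lborel k" using uv by (simp add: algebra_simps)
          finally show "norm (measure lborel k *\<^sub>R h x - F k) \<le> \<eta> * measure lborel k" .
        qed
        also have "\<dots> \<le> (\<Sum>(x, k)\<in>p. \<eta> * measure lborel k)"
          using fin \<eta> by (intro sum_mono2) auto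
        also have "\<dots> = \<eta> * (b - a)"
          using additive_content_tagged_division[of p a b] p ab
          by (simp add: sum_distrib_left[symmetric] case_prod_unfold)
        finally have A: "(\<Sum>(x, k)\<in>p - p1. norm (measure lborel k *\<^sub>R h x - F k)) < e / 2" using \<eta>(2) by simp
        have p1: "p1 tagged_partial_division_of {a..b}"
          using p by (auto simp: p1_def tagged_division_of_def intro: tagged_partial_division_subset)
        have tu: "p1 tagged_division_of \<Union>(snd ` p1)"
          using tagged_partial_division_of_Union_self[OF p1] .
        have dv: "snd ` p1 division_of \<Union>(snd ` p1)" using division_of_tagged_division[OF tu] .
        (* the empty set has to be special-cased: Sup and Inf are unspecified there *)
        define F' where "F' = (\<lambda>k. if k = {} then 0 else norm (F k))"
        have "(\<Sum>(x, k)\<in>p1. norm (measure lborel k *\<^sub>R h x - F k)) = (\<Sum>(x, k)\<in>p1. F' k)"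
          using p'(2) by (intro sum.cong) (fastforce simp: p1_def h_def F'_def)+
        \<comment> \<open>Absolute continuity speaks of untagged divisions. Forgetting the tags can
          identify only degenerate cells, and there \<open>F'\<close> vanishes.\<close>
        also have "\<dots> = (\<Sum>k\<in>snd ` p1. F' k)"
        proof (rule sum.over_tagged_division_lemma[OF tu])
          fix u v :: real assume "box u v = {}"
          then have "u = v \<or> cbox u v = {}" by auto
          then show "F' (cbox u v) = 0" by (auto simp: F_def F'_def)
        qed
        also have "\<dots> = (\<Sum>k\<in>snd ` p1. norm (F k))"
          using division_ofD(3)[OF dv] by (intro sum.cong) (auto simp: F'_def)
        also have "\<dots> < e / 2"
          unfolding F_def
        proof (rule d(2)[rule_format, OF conjI[OF dv conjI]])
          have sub: "k \<subseteq> U \<inter> {a..b}" if "k \<in> snd ` p1" for k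
          proof -
            obtain x where x: "(x, k) \<in> p" "x \<in> N" using \<open>k \<in> snd ` p1\<close> by (auto simp: p1_def)
            then show ?thesis using fineD[OF conjunct2[OF p] x(1)] p'(3)[OF x(1)] by (simp add: \<gamma>_def)
          qed
          then show "\<Union> (snd ` p1) \<subseteq> {a..b}" by auto
          have "(\<Sum>k\<in>snd ` p1. Sup k - Inf k) = (\<Sum>k\<in>snd ` p1. measure lebesgue k)"
          proof (rule sum.cong[OF refl])
            fix k assume "k \<in> snd ` p1"
            then obtain u v where "k = {u..v}" "u \<le> v" using division_real_cases[OF dv] by metis
            then show "Sup k - Inf k = measure lebesgue k" by (simp add: measure_completion)
          qed
          also have "\<dots> = measure lebesgue (\<Union> (snd ` p1))"
            using content_division[OF dv] by simp
          also have "\<dots> \<le> measure lebesgue U"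
          proof (rule measure_mono_fmeasurable)
            show "\<Union> (snd ` p1) \<subseteq> U" using sub by blast
            show "\<Union> (snd ` p1) \<in> sets lebesgue"
            proof (rule sets.finite_Union)
              show "finite (snd ` p1)" using fin by (auto simp: p1_def)
              show "snd ` p1 \<subseteq> sets lebesgue"
                using division_ofD(4)[OF dv] by (metis lmeasurable_cbox fmeasurableD subsetI)
            qed
          qed (rule Um)
          also have "\<dots> < \<delta>" by (rule Um)
          finally show "(\<Sum>k\<in>snd ` p1. Sup k - Inf k) < \<delta>" .
        qed
        finally show ?thesis using A by simp
      qed
      finally show "norm ((\<Sum>(x, k)\<in>p. measure lborel k *\<^sub>R h x) - (f b - f a)) < e" .
    qed
  qed
  then show ?thesis
    by (rule has_integral_spike[OF N, rotated]) (auto simp: h_def)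
qed


section \<open>Primitives of integrable functions on the line\<close>

lemma integral_atMost_diff:
  fixes g :: "real \<Rightarrow> 'a::euclidean_space"
  assumes g: "g absolutely_integrable_on UNIV" and "a \<le> b"
  shows "integral {..b} g - integral {..a} g = integral {a..b} g"
proof -
  have i: "g integrable_on S" if "S \<in> sets lebesgue" for S
    using g set_integrable_subset[OF g that] set_lebesgue_integral_eq_integral(1) by auto
  have "integral ({..a} \<union> {a..b}) g = integral {..a} g + integral {a..b} g"
  proof (rule integral_Un)
    have "{..a} \<inter> {a..b} \<subseteq> {a}" by auto
    then show "negligible ({..a} \<inter> {a..b})" using negligible_sing negligible_subset by blast
  qed (auto intro!: i)
  moreover have "{..a} \<union> {a..b} = {..b}" using \<open>a \<le> b\<close> by auto
  ultimately show ?thesis by simp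
qed

text \<open>\<open>integrable_ccontinuous_explicit\<close> controls averages over
  \<open>{x..x + h}\<close> with \<open>h > 0\<close>. Left averages of \<open>g\<close> are right
  averages of the reflected function, which brings in the reflection of \<open>N2\<close> as a
  second exceptional set.\<close>

lemma has_vector_derivative_indefinite_integral:
  fixes g :: "real \<Rightarrow> 'a::euclidean_space"
  assumes g: "g absolutely_integrable_on UNIV"
  obtains N where "negligible N"
    "\<And>x. x \<notin> N \<Longrightarrow> ((\<lambda>y. integral {..y} g) has_vector_derivative g x) (at x)"
proof -
  define G where "G = (\<lambda>y. integral {..y} g)"
  have int: "g integrable_on cbox a b" for a b
    using absolutely_integrable_on_subcbox[OF g] set_lebesgue_integral_eq_integral(1) by blast
  then have int': "(\<lambda>x. g (- x)) integrable_on cbox a b" for a b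
    using Henstock_Kurzweil_Integration.integrable_reflect_real[of g "-a" "-b"] by simp
  obtain N1 where N1: "negligible N1" "\<And>x e. x \<notin> N1 \<Longrightarrow> 0 < e \<Longrightarrow>
      \<exists>d>0. \<forall>h. 0 < h \<and> h < d \<longrightarrow> norm (integral (cbox x (x + h)) g /\<^sub>R h - g x) < e"
    by (rule integrable_ccontinuous_explicit[OF int]) auto
  obtain N2 where N2: "negligible N2" "\<And>x e. x \<notin> N2 \<Longrightarrow> 0 < e \<Longrightarrow>
      \<exists>d>0. \<forall>h. 0 < h \<and> h < d \<longrightarrow> norm (integral (cbox x (x + h)) (\<lambda>x. g (- x)) /\<^sub>R h - g (- x)) < e"
    by (rule integrable_ccontinuous_explicit[OF int']) auto
  have "negligible (uminus ` N2)"
    using N2(1) by (intro negligible_differentiable_image_negligible) (auto simp: differentiable_on_def)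
  then have "negligible (N1 \<union> uminus ` N2)" using N1(1) by simp
  moreover have "(G has_vector_derivative g x) (at x)" if x: "x \<notin> N1 \<union> uminus ` N2" for x
    unfolding has_vector_derivative_def has_derivative_at_alt
  proof (intro conjI allI impI)
    fix e :: real assume "e > 0"
    have "x \<notin> N1" "- x \<notin> N2" using x by force+
    obtain d1 where d1: "d1 > 0" "\<And>h. 0 < h \<Longrightarrow> h < d1 \<Longrightarrow> norm (integral {x..x + h} g /\<^sub>R h - g x) < e"
      using N1(2)[OF \<open>x \<notin> N1\<close> \<open>e > 0\<close>] by auto
    obtain d2 where d2: "d2 > 0"
      "\<And>h. 0 < h \<Longrightarrow> h < d2 \<Longrightarrow> norm (integral {-x..-x + h} (\<lambda>x. g (- x)) /\<^sub>R h - g x) < e"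
      using N2(2)[OF \<open>- x \<notin> N2\<close> \<open>e > 0\<close>] by auto
    show "\<exists>d>0. \<forall>y. norm (y - x) < d \<longrightarrow> norm (G y - G x - (y - x) *\<^sub>R g x) \<le> e * norm (y - x)"
    proof (intro exI[of _ "min d1 d2"] conjI allI impI)
      fix y assume y: "norm (y - x) < min d1 d2"
      have scale: "norm (v - h *\<^sub>R g x) \<le> e * h" if "0 < h" "norm (v /\<^sub>R h - g x) < e" for v h
      proof -
        have "v - h *\<^sub>R g x = h *\<^sub>R (v /\<^sub>R h - g x)" using that(1) by (simp add: algebra_simps)
        then have "norm (v - h *\<^sub>R g x) = h * norm (v /\<^sub>R h - g x)" using that(1) by simp
        then show ?thesis using that by (simp add: mult.commute)
      qed
      consider "x < y" | "y = x" | "y < x" by linarith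
      then show "norm (G y - G x - (y - x) *\<^sub>R g x) \<le> e * norm (y - x)"
      proof cases
        case 1
        then have "G y - G x = integral {x..x + (y - x)} g"
          using integral_atMost_diff[OF g, of x y] by (simp add: G_def)
        then show ?thesis using scale[of "y - x", OF _ d1(2)[of "y - x"]] 1 y by simp
      next
        case 3
        have "integral {-x..-x + (x - y)} (\<lambda>x. g (- x)) = integral {y..x} g"
          using Henstock_Kurzweil_Integration.integral_reflect_real[of x y g] by simp
        also have "\<dots> = G x - G y"
          using integral_atMost_diff[OF g, of y x] 3 by (simp add: G_def)
        finally have "norm ((G x - G y) - (x - y) *\<^sub>R g x) \<le> e * (x - y)"
          using scale[of "x - y", OF _ d2(2)[of "x - y"]] 3 y by simp
        moreover have "G y - G x - (y - x) *\<^sub>R g x = - ((G x - G y) - (x - y) *\<^sub>R g x)"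
          by (simp add: algebra_simps)
        ultimately show ?thesis using 3 by (metis abs_of_neg diff_less_0_iff_less minus_diff_eq norm_minus_cancel real_norm_def)
      qed simp
    qed (use d1 d2 in auto)
  qed (simp add: bounded_linear_scaleR_left)
  ultimately show thesis using that unfolding G_def by blast
qed

text \<open>Split \<open>norm g\<close> into a bounded part and a remainder of small integral.\<close>

lemma absolutely_continuous_fun_on_indefinite_integral:
  fixes g :: "real \<Rightarrow> 'a::euclidean_space"
  assumes g: "g absolutely_integrable_on UNIV"
  shows "absolutely_continuous_fun_on UNIV (\<lambda>y. integral {..y} g)"
  unfolding absolutely_continuous_fun_on_def
proof (intro allI impI)
  fix e :: real assume "e > 0"
  define r where "r = (\<lambda>n x. norm (g x) - min (norm (g x)) (real n))"
  have ng: "(\<lambda>x. norm (g x)) absolutely_integrable_on UNIV"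
    using g by (rule absolutely_integrable_norm[unfolded o_def])
  have meas: "(\<lambda>x. norm (g x)) \<in> borel_measurable lebesgue"
    using absolutely_integrable_imp_borel_measurable[OF ng] by simp
  have r: "r n absolutely_integrable_on UNIV" for n
  proof (rule measurable_bounded_by_integrable_imp_absolutely_integrable)
    show "r n \<in> borel_measurable (lebesgue_on UNIV)" using meas by (simp add: r_def)
    show "(\<lambda>x. norm (g x)) integrable_on UNIV" using ng set_lebesgue_integral_eq_integral(1) by blast
    show "norm (r n x) \<le> norm (g x)" for x by (auto simp: r_def min_def)
  qed simp
  have "(\<lambda>n. integral UNIV (r n)) \<longlonglongrightarrow> integral UNIV (\<lambda>x::real. 0)"
  proof (rule Equivalence_Lebesgue_Henstock_Integration.dominated_convergence(2))
    show "r n integrable_on UNIV" for n using r set_lebesgue_integral_eq_integral(1) by blast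
    show "(\<lambda>x. norm (g x)) integrable_on UNIV" using ng set_lebesgue_integral_eq_integral(1) by blast
    show "norm (r n x) \<le> norm (g x)" for n x by (auto simp: r_def min_def)
    show "(\<lambda>n. r n x) \<longlonglongrightarrow> 0" for x
    proof (rule tendsto_eventually)
      obtain m where "norm (g x) \<le> real m" using real_arch_simple by blast
      then show "\<forall>\<^sub>F n in sequentially. r n x = 0"
        by (intro eventually_sequentiallyI[of m]) (auto simp: r_def)
    qed
  qed
  then have "\<forall>\<^sub>F n in sequentially. integral UNIV (r n) < e / 2"
    using \<open>e > 0\<close> by (intro order_tendstoD(2)) auto
  then obtain n where n: "integral UNIV (r n) < e / 2" by (auto simp: eventually_sequentially)
  \<comment> \<open>The bounded part contributes at most \<open>n * \<delta> \<le> e / 2\<close>;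
    the added 1 covers \<open>n = 0\<close>.\<close>
  define \<delta> where "\<delta> = e / (2 * (real n + 1))"
  show "\<exists>\<delta>>0. \<forall>d t. d division_of t \<and> t \<subseteq> UNIV \<and> (\<Sum>k\<in>d. Sup k - Inf k) < \<delta> \<longrightarrow>
       (\<Sum>k\<in>d. norm (integral {..Sup k} g - integral {..Inf k} g)) < e"
  proof (intro exI[of _ \<delta>] conjI allI impI)
    show "\<delta> > 0" using \<open>e > 0\<close> by (simp add: \<delta>_def)
    fix d t assume a: "d division_of t \<and> t \<subseteq> UNIV \<and> (\<Sum>k\<in>d. Sup k - Inf k) < \<delta>"
    have d: "d division_of \<Union>d" using a division_ofD(6) by blast
    have Ud: "\<Union>d \<in> sets lebesgue"
    proof (rule sets.finite_Union)
      show "d \<subseteq> sets lebesgue"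
        using division_ofD(4)[OF d] by (metis lmeasurable_cbox fmeasurableD subsetI)
    qed (use division_ofD(1)[OF d] in simp)
    have rs: "r n integrable_on S" if "S \<in> sets lebesgue" for S
      using set_integrable_subset[OF r that] set_lebesgue_integral_eq_integral(1) by auto
    have "(\<Sum>k\<in>d. norm (integral {..Sup k} g - integral {..Inf k} g))
        \<le> (\<Sum>k\<in>d. integral k (r n) + real n * (Sup k - Inf k))"
    proof (rule sum_mono)
      fix k assume "k \<in> d"
      then obtain u v where k: "k = {u..v}" "u \<le> v" using a division_real_cases by metis
      have gi: "g integrable_on {u..v}"
        using set_integrable_subset[OF g, of "{u..v}"] set_lebesgue_integral_eq_integral(1) by auto
      have ri: "r n integrable_on {u..v}" by (rule rs) simp
      have "norm (integral {u..v} g) \<le> integral {u..v} (\<lambda>x. r n x + real n)"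
        by (rule integral_norm_bound_integral[OF gi integrable_add[OF ri]]) (auto simp: r_def)
      also have "\<dots> = integral {u..v} (r n) + real n * (v - u)"
        using k by (subst integral_add[OF ri]) (auto simp: mult.commute)
      finally show "norm (integral {..Sup k} g - integral {..Inf k} g) \<le> integral k (r n) + real n * (Sup k - Inf k)"
        using k by (simp add: integral_atMost_diff[OF g])
    qed
    also have "\<dots> = integral (\<Union>d) (r n) + real n * (\<Sum>k\<in>d. Sup k - Inf k)"
    proof -
      have "integral (\<Union>d) (r n) = (\<Sum>k\<in>d. integral k (r n))"
        by (intro integral_combine_division_topdown[OF rs[OF Ud] d])
      then show ?thesis by (simp add: sum.distrib sum_distrib_left)
    qed
    also have "\<dots> \<le> integral UNIV (r n) + real n * \<delta>"
    proof (rule add_mono)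
      show "integral (\<Union>d) (r n) \<le> integral UNIV (r n)"
        using Ud by (intro integral_subset_le rs) (auto simp: r_def)
    qed (use a in \<open>auto intro: mult_left_mono\<close>)
    also have "real n * \<delta> \<le> e / 2" using \<open>e > 0\<close> by (simp add: \<delta>_def field_simps)
    finally show "(\<Sum>k\<in>d. norm (integral {..Sup k} g - integral {..Inf k} g)) < e" using n by simp
  qed
qed

section \<open>Matrix products\<close>

lemma norm_vec_power2: "(norm (x :: 'a::real_normed_vector ^ 'n))\<^sup>2 = (\<Sum>i\<in>UNIV. (norm (x $ i))\<^sup>2)"
  unfolding norm_vec_def L2_set_def by (simp add: sum_nonneg)

text \<open>Cauchy-Schwarz for each entry, summed over rows and columns. The constant is 1 because
  the norm is the Frobenius norm.\<close>

lemma norm_matrix_mult_le: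
  fixes A B :: "complex^'n^'n"
  shows "norm (A ** B) \<le> norm A * norm B"
proof -
  have ij: "(norm ((A ** B) $ i $ j))\<^sup>2 \<le> (norm (A $ i))\<^sup>2 * (\<Sum>k\<in>UNIV. (norm (B $ k $ j))\<^sup>2)" for i j
  proof -
    have "norm ((A ** B) $ i $ j) \<le> (\<Sum>k\<in>UNIV. norm (A $ i $ k) * norm (B $ k $ j))"
      unfolding matrix_matrix_mult_def by (simp add: norm_mult[symmetric] norm_sum)
    also have "\<dots> = (\<Sum>k\<in>UNIV. \<bar>norm (A $ i $ k)\<bar> * \<bar>norm (B $ k $ j)\<bar>)" by simp
    also have "\<dots> \<le> L2_set (\<lambda>k. norm (A $ i $ k)) UNIV * L2_set (\<lambda>k. norm (B $ k $ j)) UNIV"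
      by (rule L2_set_mult_ineq)
    finally have "(norm ((A ** B) $ i $ j))\<^sup>2 \<le>
        (L2_set (\<lambda>k. norm (A $ i $ k)) UNIV * L2_set (\<lambda>k. norm (B $ k $ j)) UNIV)\<^sup>2"
      by (intro power_mono) auto
    then show ?thesis
      unfolding power_mult_distrib norm_vec_power2
      by (simp add: L2_set_def sum_nonneg)
  qed
  have "(norm (A ** B))\<^sup>2 = (\<Sum>i\<in>UNIV. \<Sum>j\<in>UNIV. (norm ((A ** B) $ i $ j))\<^sup>2)"
    by (simp add: norm_vec_power2)
  also have "\<dots> \<le> (\<Sum>i\<in>UNIV. \<Sum>j\<in>UNIV. (norm (A $ i))\<^sup>2 * (\<Sum>k\<in>UNIV. (norm (B $ k $ j))\<^sup>2))"
    by (intro sum_mono ij)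
  also have "\<dots> = (\<Sum>i\<in>UNIV. (norm (A $ i))\<^sup>2) * (\<Sum>j\<in>UNIV. \<Sum>k\<in>UNIV. (norm (B $ k $ j))\<^sup>2)"
    by (simp add: sum_product)
  also have "(\<Sum>j\<in>UNIV. \<Sum>k\<in>UNIV. (norm (B $ k $ j))\<^sup>2) = (norm B)\<^sup>2"
    by (subst sum.swap) (simp add: norm_vec_power2)
  also have "(\<Sum>i\<in>UNIV. (norm (A $ i))\<^sup>2) = (norm A)\<^sup>2" by (simp add: norm_vec_power2[of A])
  finally show ?thesis by (simp flip: power_mult_distrib)
qed

lemma bounded_bilinear_matrix_mult:
  "bounded_bilinear ((**) :: complex^'n^'n \<Rightarrow> complex^'n^'n \<Rightarrow> complex^'n^'n)"
proof
  fix a a' b b' :: "complex^'n^'n" and r :: real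
  show "(a + a') ** b = a ** b + a' ** b" "a ** (b + b') = a ** b + a ** b'"
    by (simp_all add: vec_eq_iff matrix_matrix_mult_def algebra_simps sum.distrib)
  show "(r *\<^sub>R a) ** b = r *\<^sub>R (a ** b)" "a ** (r *\<^sub>R b) = r *\<^sub>R (a ** b)"
    by (simp_all add: vec_eq_iff matrix_matrix_mult_def scaleR_sum_right)
  show "\<exists>K. \<forall>(a::complex^'n^'n) (b::complex^'n^'n). norm (a ** b) \<le> norm a * norm b * K"
    by (intro exI[of _ 1]) (auto intro: norm_matrix_mult_le)
qed

interpretation matrix_mult: bounded_bilinear "(**) :: complex^'n^'n \<Rightarrow> complex^'n^'n \<Rightarrow> complex^'n^'n"
  by (rule bounded_bilinear_matrix_mult)

lemma bilinear_matrix_mult: "bilinear ((**) :: complex^'n^'n \<Rightarrow> complex^'n^'n \<Rightarrow> complex^'n^'n)"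
  using bounded_bilinear_matrix_mult bilinear_conv_bounded_bilinear by blast

text \<open>The middle factor will be \<open>R\<close> or a difference of two such perturbations,
  which is only measurable; the outer ones, the inverse fundamental matrix and the unknown, are
  continuous.\<close>

lemma absolutely_integrable_matrix_mult3:
  fixes U V W :: "real \<Rightarrow> complex^'n^'n"
  assumes S: "S \<in> sets lebesgue" and "continuous_on S U" "V \<in> borel_measurable (lebesgue_on S)" "continuous_on S W"
    and w: "w integrable_on S" "\<And>t. t \<in> S \<Longrightarrow> norm (U t) * norm (V t) * norm (W t) \<le> w t"
  shows "(\<lambda>t. U t ** V t ** W t) absolutely_integrable_on S"
proof (rule measurable_bounded_by_integrable_imp_absolutely_integrable[OF _ S w(1)])
  show "(\<lambda>t. U t ** V t ** W t) \<in> borel_measurable (lebesgue_on S)"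
    using assms(1-4) continuous_imp_measurable_on_sets_lebesgue[OF _ S]
    by (intro borel_measurable_bilinear[OF bilinear_matrix_mult]) auto
  show "norm (U t ** V t ** W t) \<le> w t" if "t \<in> S" for t
  proof -
    have "norm (U t ** V t ** W t) \<le> norm (U t ** V t) * norm (W t)" by (rule norm_matrix_mult_le)
    also have "\<dots> \<le> norm (U t) * norm (V t) * norm (W t)"
      by (intro mult_right_mono norm_matrix_mult_le) auto
    finally show ?thesis using w(2)[OF that] by simp
  qed
qed

text \<open>\<open>M\<close> is moved under the integral before norms are taken. With
  \<open>M = \<Phi> x\<close> and \<open>G t\<close> starting with \<open>V t\<close>, it is the
  product \<open>\<Phi> x ** V t\<close> that has the exponential bound; a product of separate norms
  would lose it.\<close>

lemma norm_matrix_mult_integral_le: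
  fixes G :: "real \<Rightarrow> complex^'n^'n" and M :: "complex^'n^'n"
  assumes "G integrable_on S" "w integrable_on S" "\<And>t. t \<in> S \<Longrightarrow> norm (M ** G t) \<le> w t"
  shows "norm (M ** integral S G) \<le> integral S w"
proof -
  have bl: "bounded_linear (\<lambda>X::complex^'n^'n. M ** X)" by (rule matrix_mult.bounded_linear_right)
  have "integral S (\<lambda>t. M ** G t) = M ** integral S G"
    using integral_linear[OF assms(1) bl] by (simp add: o_def)
  moreover have "(\<lambda>t. M ** G t) integrable_on S"
    using integrable_linear[OF assms(1) bl] by (simp add: o_def)
  ultimately show ?thesis
    using integral_norm_bound_integral[of "\<lambda>t. M ** G t" S w] assms by simp
qed

section \<open>Gronwall's inequality and Volterra equations on a half-line\<close>

text \<open>Makes \<open>exp (L * m)\<close> absolutely continuous: the exponent is bounded above,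
  and exp is Lipschitz there because 1 + z \<le> exp z.\<close>

lemma abs_exp_diff_le:
  assumes "u \<le> (B::real)" "v \<le> B"
  shows "\<bar>exp v - exp u\<bar> \<le> exp B * \<bar>v - u\<bar>"
proof -
  have *: "exp y - exp x \<le> exp B * (y - x)" if "x \<le> y" "y \<le> B" for x y :: real
  proof -
    have "exp y - exp x = exp y * (1 - exp (x - y))" by (simp add: right_diff_distrib flip: exp_add)
    also have "\<dots> \<le> exp y * (y - x)"
      using exp_ge_add_one_self[of "x - y"] by (intro mult_left_mono) (linarith, simp)
    also have "\<dots> \<le> exp B * (y - x)" using that by (intro mult_right_mono) auto
    finally show ?thesis .
  qed
  show ?thesis
  proof (cases "u \<le> v")
    case True
    then show ?thesis using *[of u v] assms by simp
  next
    case False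
    then have "\<bar>exp v - exp u\<bar> = exp u - exp v" "\<bar>v - u\<bar> = u - v" by auto
    then show ?thesis using *[of v u] assms False by simp
  qed
qed

lemma integral_atMost_tendsto_0:
  fixes g :: "real \<Rightarrow> 'a::euclidean_space"
  assumes g: "g absolutely_integrable_on UNIV"
  shows "(\<lambda>n. integral {..- real n} g) \<longlonglongrightarrow> 0"
proof -
  have "(\<lambda>n. integral UNIV (\<lambda>x. if x \<in> {..- real n} then g x else 0)) \<longlonglongrightarrow> integral UNIV (\<lambda>x::real. 0::'a)"
  proof (rule Equivalence_Lebesgue_Henstock_Integration.dominated_convergence(2))
    show "(\<lambda>x. if x \<in> {..- real n} then g x else 0) integrable_on UNIV" for n
      unfolding integrable_restrict_UNIV
      using set_integrable_subset[OF g, of "{..- real n}"] set_lebesgue_integral_eq_integral(1) by auto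
    show "(\<lambda>x. norm (g x)) integrable_on UNIV"
      using g by (simp add: absolutely_integrable_on_def)
    show "(\<lambda>n. if x \<in> {..- real n} then g x else 0) \<longlonglongrightarrow> 0" for x
    proof (rule tendsto_eventually)
      obtain m where "- x < real m" using reals_Archimedean2 by blast
      then show "\<forall>\<^sub>F n in sequentially. (if x \<in> {..- real n} then g x else 0) = 0"
        by (intro eventually_sequentiallyI[of m]) auto
    qed
  qed auto
  then show ?thesis by (simp only: integral_restrict_UNIV integral_0)
qed

section \<open>Exponential weights from an integrable density, and Gronwall's inequality\<close>

locale nonneg_L1 =
  fixes \<rho> :: "real \<Rightarrow> real"
  assumes integrable: "\<rho> absolutely_integrable_on UNIV" and nonneg: "\<rho> t \<ge> 0"
begin

definition m where "m x = integral {..x} \<rho>"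

lemma integrable_on: "S \<in> sets lebesgue \<Longrightarrow> \<rho> integrable_on S"
  using set_integrable_subset[OF integrable] set_lebesgue_integral_eq_integral(1) by auto

lemma m_nonneg: "m x \<ge> 0"
  unfolding m_def by (rule integral_nonneg) (auto simp: nonneg integrable_on)

lemma m_le: "m x \<le> integral UNIV \<rho>"
  unfolding m_def by (rule integral_subset_le) (auto simp: nonneg integrable_on)

lemma m_AC: "absolutely_continuous_fun_on UNIV m"
  unfolding m_def[abs_def] by (rule absolutely_continuous_fun_on_indefinite_integral[OF integrable])

lemma m_continuous: "continuous_on S m"
  using absolutely_continuous_fun_on_imp_continuous_on[OF m_AC] continuous_on_subset
  by (metis is_interval_univ subset_UNIV)

lemma exp_m_integrable: "(\<lambda>t. \<rho> t * exp (L * m t)) absolutely_integrable_on UNIV"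
proof -
  have "(\<lambda>t. exp (L * m t) * \<rho> t) absolutely_integrable_on UNIV"
  proof (rule absolutely_integrable_bounded_measurable_product_real[OF _ _ _ integrable])
    show "(\<lambda>t. exp (L * m t)) \<in> borel_measurable (lebesgue_on UNIV)"
      by (intro continuous_imp_measurable_on_sets_lebesgue continuous_intros m_continuous) auto
    have "\<bar>L * m t\<bar> \<le> \<bar>L\<bar> * integral UNIV \<rho>" for t
      using m_le[of t] m_nonneg[of t] by (simp add: abs_mult mult_left_mono)
    then have *: "norm (exp (L * m t)) \<le> exp (\<bar>L\<bar> * integral UNIV \<rho>)" for t
      by (simp add: abs_le_iff)
    show "bounded (range (\<lambda>t. exp (L * m t)))"
      by (rule boundedI[of _ "exp (\<bar>L\<bar> * integral UNIV \<rho>)"]) (use * in auto)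
  qed auto
  then show ?thesis by (simp add: mult.commute)
qed

lemma exp_m_integrable_on: "S \<in> sets lebesgue \<Longrightarrow> (\<lambda>t. \<rho> t * exp (L * m t)) integrable_on S"
  using set_integrable_subset[OF exp_m_integrable] set_lebesgue_integral_eq_integral(1) by auto

text \<open>The integrand is almost everywhere the derivative of \<open>exp (L * m t) / L\<close>.
  The fundamental theorem applies on \<open>{a..x}\<close>, the lower boundary term has the right
  sign, and then \<open>a\<close> runs through \<open>- real n\<close>.\<close>

lemma integral_exp_m_le:
  assumes L: "L > 0"
  shows "integral {..x} (\<lambda>t. \<rho> t * exp (L * m t)) \<le> exp (L * m x) / L"
proof -
  let ?g = "\<lambda>t. \<rho> t * exp (L * m t)"
  obtain N where N: "negligible N" "\<And>x. x \<notin> N \<Longrightarrow> (m has_vector_derivative \<rho> x) (at x)"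
    using has_vector_derivative_indefinite_integral[OF integrable] unfolding m_def[abs_def] by metis
  have ac: "absolutely_continuous_fun_on UNIV (\<lambda>t. exp (L * m t))"
  proof (rule absolutely_continuous_fun_on_dominated[OF m_AC m_AC])
    fix x y :: real
    have "L * m z \<le> L * integral UNIV \<rho>" for z using L m_le by simp
    then have "\<bar>exp (L * m y) - exp (L * m x)\<bar> \<le> exp (L * integral UNIV \<rho>) * \<bar>L * m y - L * m x\<bar>"
      by (intro abs_exp_diff_le) auto
    also have "\<dots> = exp (L * integral UNIV \<rho>) * L * \<bar>m y - m x\<bar>"
      using L by (simp add: abs_mult flip: right_diff_distrib)
    also have "\<dots> \<le> exp (L * integral UNIV \<rho>) * L * (\<bar>m y - m x\<bar> + \<bar>m y - m x\<bar>)"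
      using L by (intro mult_left_mono) auto
    finally show "norm (exp (L * m y) - exp (L * m x)) \<le>
        exp (L * integral UNIV \<rho>) * L * (norm (m y - m x) + norm (m y - m x))" by simp
  qed
  have bd: "integral {a..x} ?g \<le> exp (L * m x) / L" if "a \<le> x" for a
  proof -
    have "((\<lambda>t. L * ?g t) has_integral exp (L * m x) - exp (L * m a)) {a..x}"
    proof (rule fundamental_theorem_of_calculus_absolutely_continuous[OF that _ N(1)])
      show "absolutely_continuous_fun_on {a..x} (\<lambda>t. exp (L * m t))"
        using ac by (rule absolutely_continuous_fun_on_subset) simp
      fix t assume "t \<in> {a..x} - N"
      then have "(m has_real_derivative \<rho> t) (at t)"
        using N(2) by (simp add: has_real_derivative_iff_has_vector_derivative)
      then have "((\<lambda>t. exp (L * m t)) has_real_derivative L * ?g t) (at t)"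
        by (auto intro!: derivative_eq_intros simp: mult_ac)
      then show "((\<lambda>t. exp (L * m t)) has_vector_derivative L * ?g t) (at t within {a..x})"
        using has_real_derivative_iff_has_vector_derivative has_vector_derivative_at_within by blast
    qed
    then have "integral {a..x} (\<lambda>t. L * ?g t) = exp (L * m x) - exp (L * m a)" by (rule integral_unique)
    then have "L * integral {a..x} ?g = exp (L * m x) - exp (L * m a)" by simp
    also have "\<dots> \<le> exp (L * m x)" by simp
    finally show ?thesis using L by (simp add: field_simps)
  qed
  have "(\<lambda>n. integral {..x} ?g - integral {..- real n} ?g) \<longlonglongrightarrow> integral {..x} ?g - 0"
    by (intro tendsto_intros integral_atMost_tendsto_0 exp_m_integrable)
  moreover have "\<forall>\<^sub>F n in sequentially. integral {..x} ?g - integral {..- real n} ?g \<le> exp (L * m x) / L"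
  proof -
    obtain k where "- x \<le> real k" using real_arch_simple by blast
    then show ?thesis
      using bd by (intro eventually_sequentiallyI[of k]) (subst integral_atMost_diff[OF exp_m_integrable], auto)
  qed
  ultimately show ?thesis using tendsto_upperbound by fastforce
qed

lemma mult_integrable_on:
  assumes u: "continuous_on {..b} u" "\<And>t. t \<le> b \<Longrightarrow> 0 \<le> u t" "\<And>t. t \<le> b \<Longrightarrow> u t \<le> M"
    and S: "S \<in> sets lebesgue" "S \<subseteq> {..b}"
  shows "(\<lambda>t. \<rho> t * u t) integrable_on S"
proof (rule measurable_bounded_by_integrable_imp_integrable_real[OF _ _ _ S(1)])
  have "u \<in> borel_measurable (lebesgue_on S)"
    using S by (intro continuous_imp_measurable_on_sets_lebesgue continuous_on_subset[OF u(1)])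
  then show "(\<lambda>t. \<rho> t * u t) \<in> borel_measurable (lebesgue_on S)"
    using integrable_imp_measurable[OF integrable_on[OF S(1)]] by (intro borel_measurable_times)
  show "(\<lambda>t. M * \<rho> t) integrable_on S" by (intro integrable_on_mult_right integrable_on S)
  fix t assume "t \<in> S"
  then have "t \<le> b" using S(2) by auto
  then show "\<bar>\<rho> t * u t\<bar> \<le> M * \<rho> t"
    using u(2,3)[of t] nonneg[of t] mult_left_mono[OF u(3)[of t] nonneg[of t]] by (simp add: abs_mult mult.commute)
qed

text \<open>No iteration: with \<open>L = 2 * C\<close> the hypothesis turns into
  \<open>N \<le> a + N / 2\<close> for the weighted supremum \<open>N\<close>, hence
  \<open>N \<le> 2 * a\<close>. The bound \<open>M\<close> makes \<open>N\<close> finite, which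
  permits the absorption; the factor 2 in the conclusion is its price.\<close>

lemma gronwall_atMost:
  assumes C: "C > 0" and a: "a \<ge> 0"
    and u: "continuous_on {..b} u" "\<And>t. t \<le> b \<Longrightarrow> 0 \<le> u t" "\<And>t. t \<le> b \<Longrightarrow> u t \<le> M"
    and le: "\<And>x. x \<le> b \<Longrightarrow> u x \<le> a + C * integral {..x} (\<lambda>t. \<rho> t * u t)"
    and x: "x \<le> b"
  shows "u x \<le> 2 * a * exp (2 * C * m x)"
proof -
  define L where "L = 2 * C"
  define N where "N = (SUP x\<in>{..b}. u x / exp (L * m x))"
  have L: "L > 0" using C by (simp add: L_def)
  have e1: "1 \<le> exp (L * m x)" for x using L m_nonneg by simp
  have "u t / exp (L * m t) \<le> M" if "t \<le> b" for t
  proof -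
    have "u t / exp (L * m t) \<le> u t / 1" using u(2)[OF that] e1 by (intro divide_left_mono) auto
    then show ?thesis using u(3)[OF that] by simp
  qed
  then have bdd: "bdd_above ((\<lambda>x. u x / exp (L * m x)) ` {..b})" by (intro bdd_aboveI[of _ M]) auto
  have N: "u t / exp (L * m t) \<le> N" if "t \<le> b" for t
    unfolding N_def using that by (intro cSUP_upper bdd) auto
  have "N \<ge> 0" using order_trans[OF _ N[OF x]] u(2)[OF x] by simp
  have "u t / exp (L * m t) \<le> a + N / 2" if t: "t \<le> b" for t
  proof -
    have "integral {..t} (\<lambda>s. \<rho> s * u s) \<le> integral {..t} (\<lambda>s. N * (\<rho> s * exp (L * m s)))"
    proof (rule integral_le)
      show "(\<lambda>s. \<rho> s * u s) integrable_on {..t}" using t by (intro mult_integrable_on[OF u]) auto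
      show "(\<lambda>s. N * (\<rho> s * exp (L * m s))) integrable_on {..t}"
        by (intro integrable_on_mult_right exp_m_integrable_on) auto
      fix s assume "s \<in> {..t}"
      then have "u s \<le> N * exp (L * m s)" using N[of s] t by (simp add: divide_le_eq)
      then show "\<rho> s * u s \<le> N * (\<rho> s * exp (L * m s))"
        using mult_left_mono[OF _ nonneg[of s], of "u s" "N * exp (L * m s)"] by (simp add: mult_ac)
    qed
    also have "\<dots> = N * integral {..t} (\<lambda>s. \<rho> s * exp (L * m s))" by simp
    also have "\<dots> \<le> N * (exp (L * m t) / L)" using \<open>N \<ge> 0\<close> integral_exp_m_le[OF L] by (intro mult_left_mono)
    finally have "C * integral {..t} (\<lambda>s. \<rho> s * u s) \<le> C * (N * (exp (L * m t) / L))"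
      using C by (intro mult_left_mono) auto
    then have "u t \<le> a + N / 2 * exp (L * m t)" using le[OF t] C by (simp add: L_def)
    also have "\<dots> \<le> (a + N / 2) * exp (L * m t)" using a e1[of t] mult_left_mono[OF e1[of t] a] by (simp add: algebra_simps)
    finally show ?thesis by (simp add: divide_le_eq)
  qed
  \<comment> \<open>Only the \<open>N\<close> on the left is unfolded: the bound just proved for
    every quotient passes to the supremum.\<close>
  then have "N \<le> a + N / 2" unfolding N_def[symmetric]
    by (subst (1) N_def) (rule cSUP_least, use x in auto)
  then have "N \<le> 2 * a" by simp
  then have "u x / exp (L * m x) \<le> 2 * a" using N[OF x] by linarith
  then show ?thesis by (simp add: divide_le_eq L_def)
qed

end

section \<open>Primitives on a half-line and calculus for matrix functions\<close>

lemma absolutely_integrable_extend_0: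
  fixes g :: "real \<Rightarrow> 'a::euclidean_space"
  assumes "g absolutely_integrable_on {..b}"
  shows "(\<lambda>t. if t \<le> b then g t else 0) absolutely_integrable_on UNIV"
  using absolutely_integrable_restrict_UNIV[of "{..b}" g] assms by simp

lemma nonneg_L1_norm:
  fixes R :: "real \<Rightarrow> 'a::euclidean_space"
  assumes "R absolutely_integrable_on {..b}"
  shows "nonneg_L1 (\<lambda>t. if t \<le> b then norm (R t) else 0)"
proof
  show "(\<lambda>t. if t \<le> b then norm (R t) else 0) absolutely_integrable_on UNIV"
    using assms by (intro absolutely_integrable_extend_0 absolutely_integrable_norm[unfolded o_def])
qed simp

lemma integral_extend_0:
  "x \<le> b \<Longrightarrow> integral {..x} (\<lambda>t. if t \<le> b then g t else 0) = integral {..x} (g :: real \<Rightarrow> 'a::euclidean_space)"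
  by (rule integral_cong) auto

lemma absolutely_continuous_fun_on_cong:
  assumes "\<And>x. x \<in> S \<Longrightarrow> f x = g x" "absolutely_continuous_fun_on S f"
  shows "absolutely_continuous_fun_on S g"
  by (rule absolutely_continuous_fun_on_dominated[OF assms(2,2), where K=1]) (use assms(1) in auto)

lemma absolutely_continuous_fun_on_integral_atMost:
  fixes g :: "real \<Rightarrow> 'a::euclidean_space"
  assumes "g absolutely_integrable_on {..b}"
  shows "absolutely_continuous_fun_on {..b} (\<lambda>x. integral {..x} g)"
  using absolutely_continuous_fun_on_subset[OF absolutely_continuous_fun_on_indefinite_integral[OF absolutely_integrable_extend_0[OF assms]], of "{..b}"]
  by (rule absolutely_continuous_fun_on_cong[rotated]) (auto simp: integral_extend_0)

lemma continuous_on_integral_atMost: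
  fixes g :: "real \<Rightarrow> 'a::euclidean_space"
  assumes "g absolutely_integrable_on {..b}"
  shows "continuous_on {..b} (\<lambda>x. integral {..x} g)"
  using absolutely_continuous_fun_on_integral_atMost[OF assms]
  by (rule absolutely_continuous_fun_on_imp_continuous_on) (rule is_interval_ic)

text \<open>Strictly below \<open>b\<close> the primitive agrees near \<open>x\<close> with that of
  the extension by 0; beyond \<open>b\<close> the integrand is uncontrolled, so \<open>b\<close>
  itself is left out.\<close>

lemma AE_has_vector_derivative_integral_atMost:
  fixes g :: "real \<Rightarrow> 'a::euclidean_space"
  assumes "g absolutely_integrable_on {..b}"
  shows "AE x in lebesgue. x < b \<longrightarrow> ((\<lambda>y. integral {..y} g) has_vector_derivative g x) (at x)"
proof -
  let ?g = "\<lambda>t. if t \<le> b then g t else 0"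
  obtain N where N: "negligible N"
    "\<And>x. x \<notin> N \<Longrightarrow> ((\<lambda>y. integral {..y} ?g) has_vector_derivative ?g x) (at x)"
    by (rule has_vector_derivative_indefinite_integral[OF absolutely_integrable_extend_0[OF assms]]) blast
  have "((\<lambda>y. integral {..y} g) has_vector_derivative g x) (at x)" if "x < b" "x \<notin> N" for x
  proof (rule has_vector_derivative_transform_within_open[of _ _ _ "{..<b}"])
    show "((\<lambda>y. integral {..y} ?g) has_vector_derivative g x) (at x)" using N(2)[of x] that by simp
  qed (use that in \<open>auto simp: integral_extend_0\<close>)
  then show ?thesis
    unfolding eventually_ae_filter_negligible using N(1) by (intro exI[of _ N]) auto
qed

text \<open>The endpoints join the exceptional null set, so a solution known to be differentiable
  only inside its half-line can be integrated up to the endpoint.\<close>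

lemma has_integral_AE_derivative:
  fixes f :: "real \<Rightarrow> 'a::euclidean_space"
  assumes ab: "a \<le> b" and ac: "absolutely_continuous_fun_on {a..b} f"
    and der: "AE x in lebesgue. a < x \<and> x < b \<longrightarrow> (f has_vector_derivative g x) (at x)"
  shows "(g has_integral f b - f a) {a..b}"
proof -
  obtain N where N: "negligible N" "\<And>x. x \<notin> N \<Longrightarrow> a < x \<Longrightarrow> x < b \<Longrightarrow> (f has_vector_derivative g x) (at x)"
    using der unfolding eventually_ae_filter_negligible by blast
  have "negligible (N \<union> {a, b})" using N(1) by simp
  then show ?thesis
    by (rule fundamental_theorem_of_calculus_absolutely_continuous[OF ab ac])
      (use N(2) in \<open>auto intro: has_vector_derivative_at_within\<close>)
qed

lemma absolutely_continuous_fun_on_matrix_mult: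
  fixes f g :: "real \<Rightarrow> complex^'n^'n"
  assumes f: "absolutely_continuous_fun_on {a..b} f" and g: "absolutely_continuous_fun_on {a..b} g"
  shows "absolutely_continuous_fun_on {a..b} (\<lambda>x. f x ** g x)"
proof -
  have "continuous_on {a..b} f" "continuous_on {a..b} g"
    using assms by (auto intro!: absolutely_continuous_fun_on_imp_continuous_on is_interval_cc)
  then have "bounded (f ` {a..b})" "bounded (g ` {a..b})"
    by (auto intro!: compact_imp_bounded compact_continuous_image)
  then obtain K1 K2 where K: "K1 > 0" "K2 > 0"
    "\<And>x. x \<in> {a..b} \<Longrightarrow> norm (f x) \<le> K1" "\<And>x. x \<in> {a..b} \<Longrightarrow> norm (g x) \<le> K2"
    unfolding bounded_pos by auto
  show ?thesis
  proof (rule absolutely_continuous_fun_on_dominated[OF f g])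
    fix x y assume xy: "x \<in> {a..b}" "y \<in> {a..b}"
    have "f y ** g y - f x ** g x = (f y - f x) ** g y + f x ** (g y - g x)"
      by (simp add: matrix_mult.diff_left matrix_mult.diff_right)
    also have "norm \<dots> \<le> norm (f y - f x) * norm (g y) + norm (f x) * norm (g y - g x)"
      by (intro norm_triangle_mono norm_matrix_mult_le)
    also have "\<dots> \<le> norm (f y - f x) * (K1 + K2) + (K1 + K2) * norm (g y - g x)"
      using K(3)[OF xy(1)] K(4)[OF xy(2)] K(1,2) by (intro add_mono mult_mono) auto
    finally show "norm (f y ** g y - f x ** g x) \<le> (K1 + K2) * (norm (f y - f x) + norm (g y - g x))"
      by (simp add: algebra_simps)
  qed
qed

text \<open>The resolvent identity. It carries absolute continuity and differentiability from a
  fundamental matrix to its inverse.\<close>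

lemma inverse_matrix_diff:
  fixes U V :: "'a \<Rightarrow> complex^'n^'n"
  assumes "V y ** U y = mat 1" "U x ** V x = mat 1"
  shows "V y - V x = - (V y ** (U y - U x) ** V x)"
proof -
  have "V y ** U y ** V x = V x" "V y ** U x ** V x = V y"
    using assms by (simp_all flip: matrix_mul_assoc)
  then show ?thesis by (simp add: matrix_mult.diff_left matrix_mult.diff_right)
qed

lemma norm_inverse_matrix_diff:
  fixes U V :: "'a \<Rightarrow> complex^'n^'n"
  assumes "V y ** U y = mat 1" "U x ** V x = mat 1" "norm (V x) \<le> K" "norm (V y) \<le> K"
  shows "norm (V y - V x) \<le> K * K * norm (U y - U x)"
proof -
  have "norm (V y - V x) \<le> norm (V y ** (U y - U x)) * norm (V x)"
    unfolding inverse_matrix_diff[OF assms(1,2)] norm_minus_cancel by (rule norm_matrix_mult_le)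
  also have "\<dots> \<le> (norm (V y) * norm (U y - U x)) * norm (V x)"
    by (intro mult_right_mono norm_matrix_mult_le) auto
  also have "\<dots> \<le> (K * norm (U y - U x)) * K"
    using assms(3,4) order_trans[OF norm_ge_zero assms(3)] by (intro mult_mono) auto
  finally show ?thesis by (simp add: mult_ac)
qed

lemma has_vector_derivative_iff_tendsto:
  "(f has_vector_derivative D) (at x) \<longleftrightarrow> ((\<lambda>y. (f y - f x) /\<^sub>R (y - x)) \<longlongrightarrow> D) (at x)"
proof -
  have "(f has_vector_derivative D) (at x) \<longleftrightarrow>
      ((\<lambda>y. norm ((f y - f x) - (y - x) *\<^sub>R D) / norm (y - x)) \<longlongrightarrow> 0) (at x)"
    unfolding has_vector_derivative_def has_derivative_iff_norm
    by (simp add: bounded_linear_scaleR_left)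
  also have "\<dots> \<longleftrightarrow> ((\<lambda>y. norm ((f y - f x) /\<^sub>R (y - x) - D)) \<longlongrightarrow> 0) (at x)"
  proof (rule tendsto_cong)
    have "norm ((f y - f x) - (y - x) *\<^sub>R D) / norm (y - x) = norm ((f y - f x) /\<^sub>R (y - x) - D)"
      if "y \<noteq> x" for y
    proof -
      have "(f y - f x) /\<^sub>R (y - x) - D = ((f y - f x) - (y - x) *\<^sub>R D) /\<^sub>R (y - x)"
        using that by (simp add: scaleR_diff_right)
      then show ?thesis by (simp add: divide_inverse mult.commute)
    qed
    then show "\<forall>\<^sub>F y in at x. norm ((f y - f x) - (y - x) *\<^sub>R D) / norm (y - x) = norm ((f y - f x) /\<^sub>R (y - x) - D)"
      by (auto simp: eventually_at_filter)
  qed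
  also have "\<dots> \<longleftrightarrow> ((\<lambda>y. (f y - f x) /\<^sub>R (y - x)) \<longlongrightarrow> D) (at x)"
    unfolding tendsto_norm_zero_iff by (rule LIM_zero_iff)
  finally show ?thesis .
qed

text \<open>Divide the resolvent identity by \<open>y - x\<close> and let \<open>y\<close> tend to
  \<open>x\<close>; continuity of \<open>V\<close> takes care of the factor
  \<open>V y\<close>.\<close>

lemma has_vector_derivative_inverse_matrix:
  fixes U V :: "real \<Rightarrow> complex^'n^'n"
  assumes U: "(U has_vector_derivative U') (at x)" and S: "open S" "x \<in> S"
    and V: "\<And>y. y \<in> S \<Longrightarrow> V y ** U y = mat 1" "\<And>y. y \<in> S \<Longrightarrow> U y ** V y = mat 1"
    and cont: "isCont V x"
  shows "(V has_vector_derivative - (V x ** U' ** V x)) (at x)"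
  unfolding has_vector_derivative_iff_tendsto
proof (rule Lim_transform_eventually)
  show "((\<lambda>y. - (V y ** ((U y - U x) /\<^sub>R (y - x)) ** V x)) \<longlongrightarrow> - (V x ** U' ** V x)) (at x)"
    using U cont unfolding has_vector_derivative_iff_tendsto isCont_def
    by (intro tendsto_minus matrix_mult.tendsto tendsto_const)
  have "\<forall>\<^sub>F y in at x. y \<in> S" using S by (rule eventually_at_in_open')
  then show "\<forall>\<^sub>F y in at x. - (V y ** ((U y - U x) /\<^sub>R (y - x)) ** V x) = (V y - V x) /\<^sub>R (y - x)"
  proof eventually_elim
    case (elim y)
    then show ?case
      by (simp add: inverse_matrix_diff[of V y U x, OF V(1) V(2)] S matrix_mult.scaleR_left matrix_mult.scaleR_right)
  qed
qed

text \<open>The factor 2 in \<open>L = 2 * C\<close> makes the integral operator a contraction with constant \<open>1 / 2\<close>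
  for the weight \<open>q\<close>.\<close>

lemma volterra_half_line_exists:
  fixes U V R h :: "real \<Rightarrow> complex^'n^'n"
  assumes cont: "continuous_on {..0} U" "continuous_on {..0} V" "continuous_on {..0} h"
    and kern: "\<And>x t. t \<le> x \<Longrightarrow> x \<le> 0 \<Longrightarrow> norm (U x ** V t) \<le> C"
    and V: "\<And>t. t \<le> 0 \<Longrightarrow> norm (V t) \<le> C"
    and h: "\<And>x. x \<le> 0 \<Longrightarrow> norm (h x) \<le> N"
    and R: "R absolutely_integrable_on {..0}" and C: "C > 0"
  obtains Z B where "continuous_on {..0} Z" "\<And>x. x \<le> 0 \<Longrightarrow> norm (Z x) \<le> B"
    "\<And>x. x \<le> 0 \<Longrightarrow> Z x = h x + U x ** integral {..x} (\<lambda>t. V t ** R t ** Z t)"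
proof -
  define \<rho> where "\<rho> = (\<lambda>t. if t \<le> 0 then norm (R t) else 0)"
  interpret nonneg_L1 \<rho> unfolding \<rho>_def using R by (rule nonneg_L1_norm)
  define L where "L = 2 * C"
  define q where "q = (\<lambda>t. exp (L * m t))"
  have L: "L > 0" using C by (simp add: L_def)
  have q0: "q t > 0" for t by (simp add: q_def)
  have q1: "q t \<ge> 1" for t using L m_nonneg by (simp add: q_def)
  have q_le: "q t \<le> exp (L * integral UNIV \<rho>)" for t using L m_le by (simp add: q_def)
  have q_cont: "continuous_on S q" for S
    unfolding q_def by (intro continuous_intros m_continuous)
  have Rm: "R \<in> borel_measurable (lebesgue_on {..0})"
    using absolutely_integrable_imp_borel_measurable[OF R] by simp
  define G where "G = (\<lambda>(F :: real \<Rightarrow> complex^'n^'n) t. V t ** R t ** F t)"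
  define J where "J = (\<lambda>F x. U x ** integral {..x} (G F))"
  have \<rho>q: "(\<lambda>t. c * (\<rho> t * q t)) integrable_on S" if "S \<in> sets lebesgue" for c S
    unfolding q_def by (intro integrable_on_mult_right exp_m_integrable_on that)
  have intq: "integral {..x} (\<lambda>t. c * (\<rho> t * q t)) \<le> c * q x / L" if "c \<ge> 0" for c x
    using mult_left_mono[OF integral_exp_m_le[OF L, of x] that] by (simp add: q_def)
  have Gint: "G F absolutely_integrable_on {..0}"
    if F: "continuous_on {..0} F" "\<And>t. t \<le> 0 \<Longrightarrow> norm (F t) \<le> K * q t" for F K
    unfolding G_def
  proof (rule absolutely_integrable_matrix_mult3[OF _ cont(2) Rm F(1)])
    show "(\<lambda>t. C * K * (\<rho> t * q t)) integrable_on {..0}" by (rule \<rho>q) simp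
    fix t :: real assume "t \<in> {..0}"
    then have "norm (V t) * norm (R t) * norm (F t) \<le> C * norm (R t) * (K * q t)"
      using V F(2) C by (intro mult_mono) auto
    then show "norm (V t) * norm (R t) * norm (F t) \<le> C * K * (\<rho> t * q t)"
      using \<open>t \<in> {..0}\<close> by (simp add: \<rho>_def mult_ac)
  qed simp
  have Gint': "G F integrable_on {..x}"
    if "continuous_on {..0} F" "\<And>t. t \<le> 0 \<Longrightarrow> norm (F t) \<le> K * q t" "x \<le> 0" for F K x
    using set_integrable_subset[OF Gint[OF that(1,2)], of "{..x}"] that(3) set_lebesgue_integral_eq_integral(1)
    by auto
  have Jcont: "continuous_on {..0} (J F)"
    if "continuous_on {..0} F" "\<And>t. t \<le> 0 \<Longrightarrow> norm (F t) \<le> K * q t" for F K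
    unfolding J_def
    by (intro matrix_mult.continuous_on cont continuous_on_integral_atMost Gint[OF that])
  \<comment> \<open>The contraction: the kernel bound gives \<open>C * K\<close> times the integral
    of \<open>\<rho> t * q t\<close>, which is at most \<open>q x / L\<close>, and
    \<open>L = 2 * C\<close> leaves one half.\<close>
  have Jbound: "norm (J F x) \<le> K / 2 * q x"
    if F: "continuous_on {..0} F" "\<And>t. t \<le> 0 \<Longrightarrow> norm (F t) \<le> K * q t" and x: "x \<le> 0" for F K x
  proof -
    have "0 \<le> K * q 0" using order_trans[OF norm_ge_zero F(2)[of 0]] by simp
    then have "K \<ge> 0" using q0[of 0] by (simp add: zero_le_mult_iff)
    have "norm (J F x) \<le> integral {..x} (\<lambda>t. C * K * (\<rho> t * q t))"
      unfolding J_def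
    proof (rule norm_matrix_mult_integral_le[OF Gint'[OF F x]])
      show "(\<lambda>t. C * K * (\<rho> t * q t)) integrable_on {..x}" by (rule \<rho>q) simp
      fix t assume t: "t \<in> {..x}"
      have "norm (U x ** G F t) = norm ((U x ** V t) ** R t ** F t)"
        by (simp add: G_def matrix_mul_assoc)
      also have "\<dots> \<le> norm ((U x ** V t) ** R t) * norm (F t)" by (rule norm_matrix_mult_le)
      also have "\<dots> \<le> norm (U x ** V t) * norm (R t) * norm (F t)"
        by (intro mult_right_mono norm_matrix_mult_le) auto
      also have "\<dots> \<le> C * norm (R t) * (K * q t)"
        using kern[of t x] F(2)[of t] t x C by (intro mult_mono) auto
      finally show "norm (U x ** G F t) \<le> C * K * (\<rho> t * q t)"
        using t x by (simp add: \<rho>_def mult_ac)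
    qed
    also have "\<dots> \<le> C * K * q x / L" by (rule intq) (use C \<open>K \<ge> 0\<close> in auto)
    finally show ?thesis using C by (simp add: L_def)
  qed
  have Jdiff: "J F x - J F' x = J (\<lambda>t. F t - F' t) x"
    if "continuous_on {..0} F" "\<And>t. t \<le> 0 \<Longrightarrow> norm (F t) \<le> K * q t"
      "continuous_on {..0} F'" "\<And>t. t \<le> 0 \<Longrightarrow> norm (F' t) \<le> K' * q t" "x \<le> 0" for F F' K K' x
  proof -
    have "integral {..x} (G F) - integral {..x} (G F') = integral {..x} (G (\<lambda>t. F t - F' t))"
      using integral_diff[OF Gint'[OF that(1,2,5)] Gint'[OF that(3,4,5)]]
      by (simp add: G_def matrix_mult.diff_right)
    then show ?thesis by (simp add: J_def flip: matrix_mult.diff_right)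
  qed
  \<comment> \<open>\<open>f\<close> stands for the function \<open>q\<close> times
    \<open>f\<close>, so the supremum norm of \<open>f\<close> is a weighted norm of
    \<open>E f\<close>, and completeness comes with the type of bounded continuous
    functions.\<close>
  define E where "E = (\<lambda>(f :: real \<Rightarrow>\<^sub>C (complex^'n^'n)) t. q t *\<^sub>R f t)"
  have E: "continuous_on {..0} (E f)" "norm (E f t) \<le> norm f * q t" for f t
    unfolding E_def using q0[of t] norm_bounded[of f t]
    by (auto intro!: continuous_intros q_cont simp: mult.commute)
  \<comment> \<open>\<open>min x 0\<close> continues the function constantly to the right of 0,
    because the elements of the Banach space live on the whole line.\<close>
  define T where "T = (\<lambda>f x. (h (min x 0) + J (E f) (min x 0)) /\<^sub>R q (min x 0))"
  have T_bc: "T f \<in> bcontfun" for f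
  proof (rule bcontfun_normI)
    have "continuous_on {..0} (\<lambda>y. (h y + J (E f) y) /\<^sub>R q y)"
      using q0 by (intro continuous_intros cont Jcont[OF E] q_cont) (auto simp: less_imp_neq[symmetric])
    then show "continuous_on UNIV (T f)"
      unfolding T_def by (rule continuous_on_compose2) (auto intro!: continuous_intros)
    fix x :: real
    let ?y = "min x 0"
    have "norm (T f x) = norm (h ?y + J (E f) ?y) / q ?y"
      using q0[of ?y] by (simp add: T_def divide_inverse mult.commute)
    also have "\<dots> \<le> (N + norm f / 2 * q ?y) / q ?y"
      using q0[of ?y] Jbound[OF E, of ?y f] h[of ?y]
      by (intro divide_right_mono order_trans[OF norm_triangle_ineq] add_mono) auto
    also have "\<dots> = N / q ?y + norm f / 2" using q0[of ?y] by (simp add: field_simps)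
    also have "\<dots> \<le> N / 1 + norm f / 2"
      using q1[of ?y] order_trans[OF norm_ge_zero h[of 0]] by (intro add_mono divide_left_mono) auto
    finally show "norm (T f x) \<le> N + norm f / 2" by simp
  qed
  have "\<exists>!f. Bcontfun (T f) = f"
  proof (rule banach_fix_type[of "1 / 2"])
    show "\<forall>f g. dist (Bcontfun (T f)) (Bcontfun (T g)) \<le> 1 / 2 * dist f g"
    proof (intro allI dist_bound)
      fix f g :: "real \<Rightarrow>\<^sub>C (complex^'n^'n)" and x :: real
      let ?y = "min x 0"
      have "norm (E f t - E g t) \<le> dist f g * q t" for t
        using q0[of t] dist_bounded[of f t g] by (simp add: E_def dist_norm mult.commute flip: scaleR_diff_right)
      then have "norm (J (\<lambda>t. E f t - E g t) ?y) \<le> dist f g / 2 * q ?y"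
        by (intro Jbound continuous_on_diff E) auto
      moreover have "T f x - T g x = J (\<lambda>t. E f t - E g t) ?y /\<^sub>R q ?y"
        using Jdiff[OF E E, of ?y f g] by (simp add: T_def flip: scaleR_diff_right)
      ultimately have "norm (T f x - T g x) \<le> dist f g / 2"
        using q0[of ?y] by (simp add: field_simps)
      then show "dist (apply_bcontfun (Bcontfun (T f)) x) (apply_bcontfun (Bcontfun (T g)) x) \<le> 1 / 2 * dist f g"
        using T_bc by (simp add: Bcontfun_inverse dist_norm)
    qed
  qed auto
  then obtain f where f: "Bcontfun (T f) = f" by blast
  have fp: "f x = T f x" for x using arg_cong[OF f, of "\<lambda>g. apply_bcontfun g x"] T_bc by (simp add: Bcontfun_inverse)
  \<comment> \<open>The weight \<open>q\<close> lies between 1 and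
    \<open>exp (L * integral UNIV \<rho>)\<close>, so a weighted bound is also a plain
    bound.\<close>
  show thesis
  proof (rule that[of "E f" "norm f * exp (L * integral UNIV \<rho>)"])
    show "norm (E f x) \<le> norm f * exp (L * integral UNIV \<rho>)" for x
      using E(2)[of f x] mult_left_mono[OF q_le[of x] norm_ge_zero[of f]] by linarith
    show "E f x = h x + U x ** integral {..x} (\<lambda>t. V t ** R t ** E f t)" if "x \<le> 0" for x
    proof -
      have "E f x = h x + J (E f) x"
        using fp[of x] that q0[of x] by (simp add: E_def T_def)
      then show ?thesis by (simp add: J_def G_def)
    qed
  qed (rule E)
qed

section \<open>Fundamental systems on the negative half-line\<close>

lemma continuous_on_atMostI:
  fixes f :: "real \<Rightarrow> 'a::topological_space"
  assumes "\<And>a. continuous_on {a..b} f"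
  shows "continuous_on {..b} f"
  unfolding continuous_on_def
proof
  fix x assume x: "x \<in> {..b}"
  have "at x within {..b} = at x within {x - 1..b}"
    by (rule at_within_nhd[of _ "{x - 1<..}"]) auto
  moreover have "(f \<longlongrightarrow> f x) (at x within {x - 1..b})"
    using assms[of "x - 1"] x by (simp add: continuous_on_def)
  ultimately show "(f \<longlongrightarrow> f x) (at x within {..b})" by simp
qed

text \<open>The growth estimate that the dichotomy and the Bohl exponent supply is
  \<open>kern\<close>; all bounds on \<open>V\<close> come from it. The sign of
  \<open>\<kappa>\<close> is left open.\<close>

locale fundamental_half_line =
  fixes A \<Phi> V :: "real \<Rightarrow> complex^'n^'n" and C \<kappa> :: real
  assumes AC: "absolutely_continuous_fun_on {a..b} \<Phi>"
    and deriv: "AE x in lebesgue. (\<Phi> has_vector_derivative A x ** \<Phi> x) (at x)"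
    and inv: "x \<le> 0 \<Longrightarrow> \<Phi> x ** V x = mat 1" "x \<le> 0 \<Longrightarrow> V x ** \<Phi> x = mat 1"
    and \<Phi>0: "\<Phi> 0 = mat 1"
    and kern: "t \<le> x \<Longrightarrow> x \<le> 0 \<Longrightarrow> norm (\<Phi> x ** V t) \<le> C * exp (\<kappa> * (x - t))"
    and C: "C > 0"
begin

lemma V_bound: "t \<le> 0 \<Longrightarrow> norm (V t) \<le> C * exp (- \<kappa> * t)"
  using kern[of t 0] by (simp add: \<Phi>0)

lemma cont: "continuous_on S \<Phi>"
proof (rule continuous_on_subset[OF _ subset_UNIV])
  have "isCont \<Phi> x" for x
  proof (rule continuous_on_interior)
    show "continuous_on {x - 1..x + 1} \<Phi>"
      by (intro absolutely_continuous_fun_on_imp_continuous_on AC is_interval_cc)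
  qed auto
  then show "continuous_on UNIV \<Phi>" by (simp add: continuous_at_imp_continuous_on)
qed

text \<open>\<open>V_bound\<close> bounds \<open>V\<close> on the compact interval, so the resolvent
  identity dominates its increments by those of \<open>\<Phi>\<close>.\<close>

lemma V_AC: "b \<le> 0 \<Longrightarrow> absolutely_continuous_fun_on {a..b} V"
proof (rule absolutely_continuous_fun_on_dominated[OF AC AC])
  fix x y assume b: "b \<le> 0" and xy: "x \<in> {a..b}" "y \<in> {a..b}"
  \<comment> \<open>Absolute values because \<open>\<kappa>\<close> may have either sign;
    \<open>b \<le> 0\<close> gives \<open>\<bar>t\<bar> \<le> \<bar>a\<bar>\<close> on the
    interval.\<close>
  define K where "K = C * exp (\<bar>\<kappa>\<bar> * \<bar>a\<bar>)"
  have K: "norm (V t) \<le> K" if "t \<in> {a..b}" for t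
  proof -
    have "\<bar>- \<kappa> * t\<bar> \<le> \<bar>\<kappa>\<bar> * \<bar>a\<bar>" using that b by (auto simp: abs_mult intro!: mult_left_mono)
    then have "C * exp (- \<kappa> * t) \<le> K" using C unfolding K_def by (intro mult_left_mono) auto
    then show ?thesis using V_bound[of t] that b by simp
  qed
  have "norm (V y - V x) \<le> K * K * norm (\<Phi> y - \<Phi> x)"
    using xy b by (intro norm_inverse_matrix_diff inv K) auto
  also have "\<dots> \<le> K * K * (norm (\<Phi> y - \<Phi> x) + norm (\<Phi> y - \<Phi> x))"
    by (intro mult_left_mono) auto
  finally show "norm (V y - V x) \<le> (C * exp (\<bar>\<kappa>\<bar> * \<bar>a\<bar>)) * (C * exp (\<bar>\<kappa>\<bar> * \<bar>a\<bar>)) * (norm (\<Phi> y - \<Phi> x) + norm (\<Phi> y - \<Phi> x))"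
    unfolding K_def .
qed

lemma V_cont: "continuous_on {..0} V"
  by (intro continuous_on_atMostI absolutely_continuous_fun_on_imp_continuous_on V_AC is_interval_cc) simp

text \<open>The adjoint equation: in the derivative of an inverse the factor
  \<open>\<Phi> x ** V x\<close> cancels.\<close>

lemma V_deriv: "AE x in lebesgue. x < 0 \<longrightarrow> (V has_vector_derivative - (V x ** A x)) (at x)"
  using deriv
proof eventually_elim
  case (elim x)
  show ?case
  proof
    assume x: "x < 0"
    have "isCont V x" using x continuous_on_interior[OF V_cont, of x] by simp
    then have "(V has_vector_derivative - (V x ** (A x ** \<Phi> x) ** V x)) (at x)"
      using x by (intro has_vector_derivative_inverse_matrix[OF elim, of "{..<0}"]) (auto simp: inv)
    moreover have "V x ** (A x ** \<Phi> x) ** V x = V x ** A x"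
      using x by (simp add: inv flip: matrix_mul_assoc)
    ultimately show "(V has_vector_derivative - (V x ** A x)) (at x)" by simp
  qed
qed

text \<open>In the derivative of \<open>V t ** D t\<close> the term with \<open>A\<close> from the
  adjoint equation cancels the one from the equation for \<open>D\<close>.\<close>

lemma variation_of_constants:
  fixes D R :: "real \<Rightarrow> complex^'n^'n"
  assumes D: "\<And>a b. b \<le> 0 \<Longrightarrow> absolutely_continuous_fun_on {a..b} D"
    "AE x in lebesgue. x < 0 \<longrightarrow> (D has_vector_derivative (A x + R x) ** D x) (at x)"
    and sx: "s \<le> x" "x \<le> 0"
  shows "((\<lambda>t. V t ** R t ** D t) has_integral V x ** D x - V s ** D s) {s..x}"
proof (rule has_integral_AE_derivative[OF sx(1)])
  show "absolutely_continuous_fun_on {s..x} (\<lambda>t. V t ** D t)"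
    using sx by (intro absolutely_continuous_fun_on_matrix_mult V_AC D)
  show "AE t in lebesgue. s < t \<and> t < x \<longrightarrow>
      ((\<lambda>t. V t ** D t) has_vector_derivative V t ** R t ** D t) (at t)"
    using V_deriv D(2)
  proof eventually_elim
    case (elim t)
    show ?case
    proof
      assume t: "s < t \<and> t < x"
      have "((\<lambda>t. V t ** D t) has_vector_derivative
          V t ** ((A t + R t) ** D t) + - (V t ** A t) ** D t) (at t)"
        using elim t sx by (intro matrix_mult.has_vector_derivative) auto
      then show "((\<lambda>t. V t ** D t) has_vector_derivative V t ** R t ** D t) (at t)"
        by (simp add: matrix_mult.add_left matrix_mult.add_right matrix_mult.minus_left matrix_mul_assoc)
    qed
  qed
qed

text \<open>The exponential of the kernel is split: the part in \<open>x\<close> can leave the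
  integral, the part in \<open>t\<close> joins the unknown, which is thereby divided by
  \<open>exp (\<kappa> * t)\<close>.\<close>

lemma kern_mult:
  fixes M N :: "complex^'n^'n"
  assumes "t \<le> x" "x \<le> 0"
  shows "norm (\<Phi> x ** (V t ** M ** N)) \<le> C * exp (\<kappa> * x) * (norm M * (exp (- \<kappa> * t) * norm N))"
proof -
  have "norm (\<Phi> x ** (V t ** M ** N)) = norm ((\<Phi> x ** V t) ** M ** N)" by (simp add: matrix_mul_assoc)
  also have "\<dots> \<le> norm ((\<Phi> x ** V t) ** M) * norm N" by (rule norm_matrix_mult_le)
  also have "\<dots> \<le> norm (\<Phi> x ** V t) * norm M * norm N"
    by (intro mult_right_mono norm_matrix_mult_le) auto
  also have "\<dots> \<le> C * exp (\<kappa> * (x - t)) * norm M * norm N"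
    using kern[OF assms] by (intro mult_right_mono) auto
  also have "exp (\<kappa> * (x - t)) = exp (\<kappa> * x) * exp (- \<kappa> * t)"
    by (simp add: algebra_simps flip: exp_add)
  finally show ?thesis by (simp add: mult_ac)
qed

text \<open>Variation of constants from \<open>s\<close> to \<open>y\<close>, divided by
  \<open>exp (\<kappa> * y)\<close>, leaves the boundary term \<open>C * u s\<close>. It vanishes as
  \<open>s\<close> tends to minus infinity because \<open>\<kappa> < \<gamma>\<close>, and
  Gronwall's inequality applies with \<open>a = 0\<close>.\<close>

lemma decaying_solution_eq_0:
  fixes D R :: "real \<Rightarrow> complex^'n^'n"
  assumes D: "\<And>a b. b \<le> 0 \<Longrightarrow> absolutely_continuous_fun_on {a..b} D"
    "AE x in lebesgue. x < 0 \<longrightarrow> (D has_vector_derivative (A x + R x) ** D x) (at x)"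
    and R: "R absolutely_integrable_on {..0}"
    and decay: "\<And>x. x \<le> 0 \<Longrightarrow> norm (D x) \<le> K * exp (\<gamma> * x)" and \<gamma>: "\<kappa> < \<gamma>"
    and x: "x \<le> 0"
  shows "D x = 0"
proof -
  define \<rho> where "\<rho> = (\<lambda>t. if t \<le> 0 then norm (R t) else 0)"
  interpret nonneg_L1 \<rho> unfolding \<rho>_def using R by (rule nonneg_L1_norm)
  define u where "u = (\<lambda>t. exp (- \<kappa> * t) * norm (D t))"
  have D_cont: "continuous_on {..0} D"
    by (intro continuous_on_atMostI absolutely_continuous_fun_on_imp_continuous_on D is_interval_cc) simp
  have K: "K \<ge> 0" using order_trans[OF norm_ge_zero decay[of 0]] by simp
  have u_decay: "u t \<le> K * exp ((\<gamma> - \<kappa>) * t)" if "t \<le> 0" for t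
  proof -
    have "u t \<le> exp (- \<kappa> * t) * (K * exp (\<gamma> * t))"
      unfolding u_def using decay[OF that] by (intro mult_left_mono) auto
    also have "\<dots> = K * exp ((\<gamma> - \<kappa>) * t)" by (simp add: algebra_simps flip: exp_add)
    finally show ?thesis .
  qed
  have u_le: "u t \<le> K" if "t \<le> 0" for t
  proof -
    have "(\<gamma> - \<kappa>) * t \<le> 0" using \<gamma> that by (simp add: mult_nonneg_nonpos)
    then have "K * exp ((\<gamma> - \<kappa>) * t) \<le> K * 1" using K by (intro mult_left_mono) auto
    then show ?thesis using u_decay[OF that] by simp
  qed
  have u0: "u t \<ge> 0" for t by (simp add: u_def)
  have u_cont: "continuous_on {..0} u" unfolding u_def by (intro continuous_intros D_cont)
  note \<rho>u = mult_integrable_on[OF u_cont u0 u_le]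
  have "u x \<le> 2 * 0 * exp (2 * C * m x)"
  proof (rule gronwall_atMost[OF C order_refl u_cont u0 u_le _ x])
    show "u y \<le> 0 + C * integral {..y} (\<lambda>t. \<rho> t * u t)" if y: "y \<le> 0" for y
    proof (rule tendsto_lowerbound)
      have "((\<lambda>s. exp ((\<gamma> - \<kappa>) * s)) \<longlongrightarrow> 0) at_bot"
        using \<gamma> by (intro filterlim_compose[OF exp_at_bot] filterlim_tendsto_pos_mult_at_bot[OF tendsto_const _ filterlim_ident]) auto
      then have "((\<lambda>s. C * (K * exp ((\<gamma> - \<kappa>) * s)) + C * integral {..y} (\<lambda>t. \<rho> t * u t)) \<longlongrightarrow>
          C * (K * 0) + C * integral {..y} (\<lambda>t. \<rho> t * u t)) at_bot"
        by (intro tendsto_intros)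
      then show "((\<lambda>s. C * (K * exp ((\<gamma> - \<kappa>) * s)) + C * integral {..y} (\<lambda>t. \<rho> t * u t)) \<longlongrightarrow>
          0 + C * integral {..y} (\<lambda>t. \<rho> t * u t)) at_bot" by simp
      show "\<forall>\<^sub>F s in at_bot. u y \<le> C * (K * exp ((\<gamma> - \<kappa>) * s)) + C * integral {..y} (\<lambda>t. \<rho> t * u t)"
        using eventually_le_at_bot[of y]
      proof eventually_elim
        case (elim s)
        let ?g = "\<lambda>t. V t ** R t ** D t"
        have hi: "(?g has_integral V y ** D y - V s ** D s) {s..y}"
          by (rule variation_of_constants[OF D elim y])
        have "D y = (\<Phi> y ** V y) ** D y" by (simp add: inv y)
        also have "\<dots> = \<Phi> y ** (V s ** mat 1 ** D s) + \<Phi> y ** integral {s..y} ?g"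
          unfolding integral_unique[OF hi] by (simp add: matrix_mul_assoc matrix_mult.diff_right)
        also have "norm \<dots> \<le> norm (\<Phi> y ** V s) * norm (D s) + integral {s..y} (\<lambda>t. C * exp (\<kappa> * y) * (\<rho> t * u t))"
        proof (intro norm_triangle_mono norm_matrix_mult_integral_le)
          show "norm (\<Phi> y ** (V s ** mat 1 ** D s)) \<le> norm (\<Phi> y ** V s) * norm (D s)"
            using norm_matrix_mult_le[of "\<Phi> y ** V s" "D s"] by (simp add: matrix_mul_assoc)
          show "?g integrable_on {s..y}" using hi by blast
          show "(\<lambda>t. C * exp (\<kappa> * y) * (\<rho> t * u t)) integrable_on {s..y}"
            using y by (intro integrable_on_mult_right \<rho>u) auto
          fix t assume "t \<in> {s..y}"
          then show "norm (\<Phi> y ** (V t ** R t ** D t)) \<le> C * exp (\<kappa> * y) * (\<rho> t * u t)"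
            using kern_mult[of t y "R t" "D t"] y by (simp add: \<rho>_def u_def)
        qed
        also have "\<dots> \<le> C * exp (\<kappa> * y) * u s + C * exp (\<kappa> * y) * integral {..y} (\<lambda>t. \<rho> t * u t)"
        proof (rule add_mono)
          have "norm (\<Phi> y ** V s) * norm (D s) \<le> C * exp (\<kappa> * (y - s)) * norm (D s)"
            using kern[OF elim y] by (intro mult_right_mono) auto
          also have "exp (\<kappa> * (y - s)) = exp (\<kappa> * y) * exp (- \<kappa> * s)"
            by (simp add: algebra_simps flip: exp_add)
          finally show "norm (\<Phi> y ** V s) * norm (D s) \<le> C * exp (\<kappa> * y) * u s"
            by (simp add: u_def mult_ac)
          have "integral {s..y} (\<lambda>t. \<rho> t * u t) \<le> integral {..y} (\<lambda>t. \<rho> t * u t)"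
            using y nonneg u0 by (intro integral_subset_le \<rho>u) auto
          then show "integral {s..y} (\<lambda>t. C * exp (\<kappa> * y) * (\<rho> t * u t)) \<le> C * exp (\<kappa> * y) * integral {..y} (\<lambda>t. \<rho> t * u t)"
            using C by simp
        qed
        finally have "exp (- \<kappa> * y) * norm (D y) \<le> exp (- \<kappa> * y) *
            (C * exp (\<kappa> * y) * u s + C * exp (\<kappa> * y) * integral {..y} (\<lambda>t. \<rho> t * u t))"
          by (intro mult_left_mono) auto
        also have "\<dots> = C * u s + C * integral {..y} (\<lambda>t. \<rho> t * u t)"
          by (simp add: distrib_left exp_minus field_simps)
        also have "C * u s \<le> C * (K * exp ((\<gamma> - \<kappa>) * s))"
          using C u_decay[of s] elim y by (intro mult_left_mono) auto
        finally show ?case by (simp add: u_def)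
      qed
    qed simp
  qed auto
  then have "u x = 0" using u0[of x] by simp
  then show ?thesis by (simp add: u_def)
qed

end

section \<open>The weighted space and the Volterra equation of the Jost solution\<close>

lemma weighted_L1D:
  assumes R: "R \<in> weighted_L1 \<beta>" and \<beta>: "\<beta> \<ge> 0"
  shows "R absolutely_integrable_on {..0}"
    and "(\<lambda>t. norm (R t) * exp (\<beta> * \<bar>t\<bar>)) absolutely_integrable_on {..0}"
    and "weighted_L1_norm \<beta> R = integral {..0} (\<lambda>t. norm (R t) * exp (\<beta> * \<bar>t\<bar>))"
proof -
  have S: "{..0::real} \<in> sets lebesgue" by simp
  let ?R = "\<lambda>x. exp (\<beta> * \<bar>x\<bar>) *\<^sub>R R x"
  have R': "?R absolutely_integrable_on {..0}" using R by (simp add: weighted_L1_def)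
  show w: "(\<lambda>t. norm (R t) * exp (\<beta> * \<bar>t\<bar>)) absolutely_integrable_on {..0}"
    using absolutely_integrable_norm[OF R'] by (simp add: o_def mult.commute)
  then show "weighted_L1_norm \<beta> R = integral {..0} (\<lambda>t. norm (R t) * exp (\<beta> * \<bar>t\<bar>))"
    unfolding weighted_L1_norm_def by (rule set_lebesgue_integral_eq_integral(2))
  show "R absolutely_integrable_on {..0}"
  proof (rule measurable_bounded_by_integrable_imp_absolutely_integrable[OF _ S])
    \<comment> \<open>Measurability of \<open>R\<close> itself is recovered by undoing the
      weight.\<close>
    have "(\<lambda>x. exp (- \<beta> * \<bar>x\<bar>) *\<^sub>R ?R x) \<in> borel_measurable (lebesgue_on {..0})"
    proof (rule borel_measurable_scaleR)
      show "(\<lambda>x. exp (- \<beta> * \<bar>x\<bar>)) \<in> borel_measurable (lebesgue_on {..0})"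
        by (intro continuous_imp_measurable_on_sets_lebesgue[OF _ S] continuous_intros)
    qed (rule absolutely_integrable_imp_borel_measurable[OF R' S])
    then show "R \<in> borel_measurable (lebesgue_on {..0})" by (simp add: mult_exp_exp)
    show "(\<lambda>t. norm (R t) * exp (\<beta> * \<bar>t\<bar>)) integrable_on {..0}"
      using w set_lebesgue_integral_eq_integral(1) by blast
    show "norm (R x) \<le> norm (R x) * exp (\<beta> * \<bar>x\<bar>)" for x
      using mult_left_mono[of 1 "exp (\<beta> * \<bar>x\<bar>)" "norm (R x)"] \<beta> by simp
  qed
qed

lemma weighted_L1_diff:
  assumes "R \<in> weighted_L1 \<beta>" "R' \<in> weighted_L1 \<beta>"
  shows "(\<lambda>x. R' x - R x) \<in> weighted_L1 \<beta>"
  using assms set_integral_diff(1) by (fastforce simp: weighted_L1_def scaleR_diff_right)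

text \<open>\<open>\<kappa>\<close> bounds the growth of the propagator and \<open>\<mu>\<close> the
  decay of the free solution \<open>\<Phi> x ** P\<close>; the weight on \<open>R\<close>
  compensates the gap between them. \<open>\<beta> \<ge> 0\<close> makes the weight at least 1, so
  that \<open>R\<close> is integrable without it as well.\<close>

locale half_line_jost = fundamental_half_line A \<Phi> V C \<kappa>
  for A \<Phi> V :: "real \<Rightarrow> complex^'n^'n" and C \<kappa> +
  fixes P :: "complex^'n^'n" and C' \<mu> \<beta> :: real
  assumes P: "x \<le> 0 \<Longrightarrow> norm (\<Phi> x ** P) \<le> C' * exp (\<mu> * x)"
    and \<beta>: "\<kappa> - \<mu> \<le> \<beta>" "\<beta> \<ge> 0"
begin

text \<open>Decay at rate \<open>\<kappa>\<close> is asked of the remainder and not of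
  \<open>Y\<close>, since the free part may decay more slowly. \<open>B\<close> is a parameter
  because the continuity estimate depends on it.\<close>

definition volterra_solution :: "(real \<Rightarrow> complex^'n^'n) \<Rightarrow> (real \<Rightarrow> complex^'n^'n) \<Rightarrow> real \<Rightarrow> bool" where
  "volterra_solution R Y B \<longleftrightarrow> continuous_on {..0} Y \<and>
    (\<forall>x\<le>0. norm (Y x - \<Phi> x ** P) \<le> B * exp (\<kappa> * x)) \<and>
    (\<forall>x\<le>0. Y x = \<Phi> x ** P + \<Phi> x ** integral {..x} (\<lambda>t. V t ** R t ** Y t))"

lemma C'_nonneg: "C' \<ge> 0"
  using order_trans[OF norm_ge_zero P[of 0]] by simp

lemma P_weight:
  assumes "t \<le> 0" shows "exp (- \<kappa> * t) * norm (\<Phi> t ** P) \<le> C' * exp (\<beta> * \<bar>t\<bar>)"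
proof -
  have "exp (- \<kappa> * t) * norm (\<Phi> t ** P) \<le> exp (- \<kappa> * t) * (C' * exp (\<mu> * t))"
    using P[OF assms] by (intro mult_left_mono) auto
  also have "\<dots> = C' * exp ((\<kappa> - \<mu>) * \<bar>t\<bar>)"
    using assms by (simp add: algebra_simps mult_exp_exp)
  also have "\<dots> \<le> C' * exp (\<beta> * \<bar>t\<bar>)"
    using \<beta> C'_nonneg by (intro mult_left_mono) (auto intro: mult_right_mono)
  finally show ?thesis .
qed

text \<open>After division by \<open>exp (\<kappa> * t)\<close> the remainder is bounded and
  \<open>P_weight\<close> covers the free part; as the weight is at least 1, one bound serves
  both.\<close>

lemma volterra_solution_weight:
  assumes "volterra_solution R Y B" "t \<le> 0"
  shows "exp (- \<kappa> * t) * norm (Y t) \<le> (B + C') * exp (\<beta> * \<bar>t\<bar>)"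
proof -
  have B: "norm (Y s - \<Phi> s ** P) \<le> B * exp (\<kappa> * s)" if "s \<le> 0" for s
    using assms(1) that by (auto simp: volterra_solution_def)
  have B0: "B \<ge> 0" using order_trans[OF norm_ge_zero B[of 0]] by simp
  have "norm (Y t) \<le> norm (Y t - \<Phi> t ** P) + norm (\<Phi> t ** P)"
    using norm_triangle_ineq[of "Y t - \<Phi> t ** P" "\<Phi> t ** P"] by simp
  then have "exp (- \<kappa> * t) * norm (Y t) \<le> exp (- \<kappa> * t) * (B * exp (\<kappa> * t) + norm (\<Phi> t ** P))"
    using B[OF assms(2)] by (intro mult_left_mono) auto
  also have "\<dots> = B + exp (- \<kappa> * t) * norm (\<Phi> t ** P)" by (simp add: distrib_left exp_minus field_simps)
  also have "\<dots> \<le> B * exp (\<beta> * \<bar>t\<bar>) + C' * exp (\<beta> * \<bar>t\<bar>)"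
    using P_weight[OF assms(2)] B0 \<beta>(2) mult_left_mono[of 1 "exp (\<beta> * \<bar>t\<bar>)" B] by (intro add_mono) auto
  finally show ?thesis by (simp add: distrib_right)
qed

lemma weight_integrable:
  assumes "R \<in> weighted_L1 \<beta>" "S \<in> sets lebesgue" "S \<subseteq> {..0}"
  shows "(\<lambda>t. norm (R t) * exp (\<beta> * \<bar>t\<bar>)) integrable_on S"
  using set_integrable_subset[OF weighted_L1D(2)[OF assms(1) \<beta>(2)] assms(2,3)] set_lebesgue_integral_eq_integral(1) by auto

text \<open>One estimate for three integrands: the free solution, the rescaled fixed point, and a
  given \<open>Y\<close> paired with a change of \<open>R\<close>. \<open>kern_mult\<close> leaves
  \<open>exp (- \<kappa> * t) * norm (F t)\<close> under the integral, and the weight on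
  \<open>R\<close> absorbs its growth.\<close>

lemma integrand_weight:
  fixes F :: "real \<Rightarrow> complex^'n^'n"
  assumes R: "R \<in> weighted_L1 \<beta>" and F: "continuous_on {..0} F"
    and K: "\<And>t. t \<le> 0 \<Longrightarrow> exp (- \<kappa> * t) * norm (F t) \<le> K * exp (\<beta> * \<bar>t\<bar>)"
  shows integrand_absolutely_integrable: "(\<lambda>t. V t ** R t ** F t) absolutely_integrable_on {..0}"
    and integral_weight_le: "x \<le> 0 \<Longrightarrow> exp (- \<kappa> * x) * norm (\<Phi> x ** integral {..x} (\<lambda>t. V t ** R t ** F t)) \<le> C * K * weighted_L1_norm \<beta> R"
proof -
  let ?w = "\<lambda>t. norm (R t) * exp (\<beta> * \<bar>t\<bar>)"
  have S: "{..0::real} \<in> sets lebesgue" by simp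
  have K0: "K \<ge> 0"
  proof -
    have "0 \<le> exp (- \<kappa> * 0) * norm (F 0)" by simp
    also have "\<dots> \<le> K" using K[of 0] by simp
    finally show ?thesis .
  qed
  show int: "(\<lambda>t. V t ** R t ** F t) absolutely_integrable_on {..0}"
  proof (rule absolutely_integrable_matrix_mult3[OF S V_cont _ F])
    show "R \<in> borel_measurable (lebesgue_on {..0})"
      using absolutely_integrable_imp_borel_measurable[OF weighted_L1D(1)[OF R \<beta>(2)] S] .
    show "(\<lambda>t. C * K * ?w t) integrable_on {..0}"
      by (intro integrable_on_mult_right weight_integrable R) auto
    fix t :: real assume "t \<in> {..0}"
    then have t: "t \<le> 0" by simp
    have "norm (V t) * norm (R t) * norm (F t) \<le> C * exp (- \<kappa> * t) * norm (R t) * norm (F t)"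
      using V_bound[OF t] by (intro mult_right_mono) auto
    also have "\<dots> = C * norm (R t) * (exp (- \<kappa> * t) * norm (F t))" by simp
    also have "\<dots> \<le> C * norm (R t) * (K * exp (\<beta> * \<bar>t\<bar>))"
      using K[OF t] C by (intro mult_left_mono) auto
    finally show "norm (V t) * norm (R t) * norm (F t) \<le> C * K * ?w t" by (simp add: mult_ac)
  qed
  assume x: "x \<le> 0"
  have "norm (\<Phi> x ** integral {..x} (\<lambda>t. V t ** R t ** F t)) \<le> integral {..x} (\<lambda>t. C * exp (\<kappa> * x) * K * ?w t)"
  proof (rule norm_matrix_mult_integral_le)
    show "(\<lambda>t. V t ** R t ** F t) integrable_on {..x}"
      using set_integrable_subset[OF int, of "{..x}"] x set_lebesgue_integral_eq_integral(1) by auto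
    show "(\<lambda>t. C * exp (\<kappa> * x) * K * ?w t) integrable_on {..x}"
      using x by (intro integrable_on_mult_right weight_integrable R) auto
    fix t assume "t \<in> {..x}"
    then have t: "t \<le> x" "t \<le> 0" using x by auto
    have "C * exp (\<kappa> * x) * (norm (R t) * (exp (- \<kappa> * t) * norm (F t))) \<le> C * exp (\<kappa> * x) * (norm (R t) * (K * exp (\<beta> * \<bar>t\<bar>)))"
      using C K[OF t(2)] by (intro mult_left_mono) auto
    then show "norm (\<Phi> x ** (V t ** R t ** F t)) \<le> C * exp (\<kappa> * x) * K * ?w t"
      using kern_mult[OF t(1) x, of "R t" "F t"] by (simp add: mult_ac)
  qed
  also have "\<dots> = C * exp (\<kappa> * x) * K * integral {..x} ?w" by simp
  also have "\<dots> \<le> C * exp (\<kappa> * x) * K * weighted_L1_norm \<beta> R"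
    unfolding weighted_L1D(3)[OF R \<beta>(2)] using x C K0
    by (intro mult_left_mono integral_subset_le weight_integrable R) auto
  finally have "exp (- \<kappa> * x) * norm (\<Phi> x ** integral {..x} (\<lambda>t. V t ** R t ** F t)) \<le> exp (- \<kappa> * x) * (C * exp (\<kappa> * x) * K * weighted_L1_norm \<beta> R)"
    by (intro mult_left_mono) auto
  also have "\<dots> = C * K * weighted_L1_norm \<beta> R" by (simp add: exp_minus field_simps)
  finally show "exp (- \<kappa> * x) * norm (\<Phi> x ** integral {..x} (\<lambda>t. V t ** R t ** F t)) \<le> C * K * weighted_L1_norm \<beta> R" .
qed

text \<open>\<open>Y\<close> is the free solution plus \<open>exp (\<kappa> * x)\<close> times a
  bounded \<open>Z\<close>. The free part is kept apart because it may become unbounded after the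
  division; it enters the equation for \<open>Z\<close> only through the bounded inhomogeneity
  \<open>h\<close>.\<close>

lemma volterra_solution_exists:
  assumes R: "R \<in> weighted_L1 \<beta>"
  obtains Y B where "volterra_solution R Y B"
proof -
  \<comment> \<open>The exponentials move into the factors, so that \<open>U x ** V' t\<close> is
    \<open>exp (- \<kappa> * (x - t))\<close> times the kernel and hence bounded by
    \<open>C\<close>.\<close>
  define U where "U = (\<lambda>x. exp (- \<kappa> * x) *\<^sub>R \<Phi> x)"
  define V' where "V' = (\<lambda>x. exp (\<kappa> * x) *\<^sub>R V x)"
  have P_cont: "continuous_on {..0} (\<lambda>t. \<Phi> t ** P)"
    by (intro matrix_mult.continuous_on cont continuous_intros)
  have int_P: "(\<lambda>t. V t ** R t ** (\<Phi> t ** P)) absolutely_integrable_on {..0}"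
    by (rule integrand_absolutely_integrable[OF R P_cont P_weight])
  define h where "h = (\<lambda>x. U x ** integral {..x} (\<lambda>t. V t ** R t ** (\<Phi> t ** P)))"
  have U_cont: "continuous_on {..0} U" unfolding U_def by (intro continuous_intros cont)
  obtain Z B where Z: "continuous_on {..0} Z" "\<And>x. x \<le> 0 \<Longrightarrow> norm (Z x) \<le> B"
    "\<And>x. x \<le> 0 \<Longrightarrow> Z x = h x + U x ** integral {..x} (\<lambda>t. V' t ** R t ** Z t)"
  proof (rule volterra_half_line_exists[of U V' h C _ R])
    show "continuous_on {..0} U" by (rule U_cont)
    show "continuous_on {..0} V'" unfolding V'_def by (intro continuous_intros V_cont)
    show "continuous_on {..0} h" unfolding h_def
      by (intro matrix_mult.continuous_on U_cont continuous_on_integral_atMost int_P)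
    show "norm (U x ** V' t) \<le> C" if "t \<le> x" "x \<le> 0" for x t
    proof -
      have "norm (U x ** V' t) = exp (- \<kappa> * (x - t)) * norm (\<Phi> x ** V t)"
        by (simp add: U_def V'_def matrix_mult.scaleR_left matrix_mult.scaleR_right mult_exp_exp algebra_simps)
      also have "\<dots> \<le> exp (- \<kappa> * (x - t)) * (C * exp (\<kappa> * (x - t)))"
        using kern[OF that] by (intro mult_left_mono) auto
      also have "\<dots> = C" by (simp add: mult.left_commute[of _ C] mult_exp_exp)
      finally show ?thesis .
    qed
    show "norm (V' t) \<le> C" if "t \<le> 0" for t
    proof -
      have "norm (V' t) \<le> exp (\<kappa> * t) * (C * exp (- \<kappa> * t))"
        unfolding V'_def using V_bound[OF that] by simp
      then show ?thesis by (simp add: exp_minus field_simps)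
    qed
    show "norm (h x) \<le> C * C' * weighted_L1_norm \<beta> R" if "x \<le> 0" for x
      using integral_weight_le[OF R P_cont P_weight that] by (simp add: h_def U_def matrix_mult.scaleR_left)
  qed (use C R \<beta> weighted_L1D in auto)
  define Y where "Y = (\<lambda>x. \<Phi> x ** P + exp (\<kappa> * x) *\<^sub>R Z x)"
  have Ze_cont: "continuous_on {..0} (\<lambda>t. exp (\<kappa> * t) *\<^sub>R Z t)" by (intro continuous_intros Z)
  have Ze_w: "exp (- \<kappa> * t) * norm (exp (\<kappa> * t) *\<^sub>R Z t) \<le> B * exp (\<beta> * \<bar>t\<bar>)" if "t \<le> 0" for t
  proof -
    have "B \<ge> 0" using order_trans[OF norm_ge_zero Z(2)[of 0]] by simp
    have "exp (- \<kappa> * t) * norm (exp (\<kappa> * t) *\<^sub>R Z t) = norm (Z t)" by (simp add: exp_minus field_simps)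
    also have "\<dots> \<le> B * 1" using Z(2)[OF that] by simp
    also have "\<dots> \<le> B * exp (\<beta> * \<bar>t\<bar>)" using \<open>B \<ge> 0\<close> \<beta>(2) by (intro mult_left_mono) auto
    finally show ?thesis .
  qed
  have int_Z: "(\<lambda>t. V t ** R t ** (exp (\<kappa> * t) *\<^sub>R Z t)) absolutely_integrable_on {..0}"
    by (rule integrand_absolutely_integrable[OF R Ze_cont Ze_w])
  have "volterra_solution R Y B"
    unfolding volterra_solution_def
  proof (intro conjI allI impI)
    show "continuous_on {..0} Y" unfolding Y_def by (intro continuous_on_add P_cont Ze_cont)
    fix x :: real assume x: "x \<le> 0"
    show "norm (Y x - \<Phi> x ** P) \<le> B * exp (\<kappa> * x)" using Z(2)[OF x] by (simp add: Y_def mult.commute)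
    have i: "f integrable_on {..x}" if "f absolutely_integrable_on {..0}" for f :: "real \<Rightarrow> complex^'n^'n"
      using set_integrable_subset[OF that, of "{..x}"] x set_lebesgue_integral_eq_integral(1) by auto
    have "exp (\<kappa> * x) *\<^sub>R Z x = \<Phi> x ** integral {..x} (\<lambda>t. V t ** R t ** (\<Phi> t ** P))
        + \<Phi> x ** integral {..x} (\<lambda>t. V t ** R t ** (exp (\<kappa> * t) *\<^sub>R Z t))"
      unfolding Z(3)[OF x] h_def U_def V'_def
      by (simp add: scaleR_add_right matrix_mult.scaleR_left matrix_mult.scaleR_right mult_exp_exp)
    also have "\<dots> = \<Phi> x ** integral {..x} (\<lambda>t. V t ** R t ** (\<Phi> t ** P) + V t ** R t ** (exp (\<kappa> * t) *\<^sub>R Z t))"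
      by (simp add: integral_add[OF i[OF int_P] i[OF int_Z]] matrix_mult.add_right)
    also have "\<dots> = \<Phi> x ** integral {..x} (\<lambda>t. V t ** R t ** Y t)"
      by (simp add: Y_def matrix_mult.add_right)
    finally show "Y x = \<Phi> x ** P + \<Phi> x ** integral {..x} (\<lambda>t. V t ** R t ** Y t)" by (simp add: Y_def)
  qed
  then show thesis by (rule that)
qed

lemma volterra_solution_integrand:
  assumes "R \<in> weighted_L1 \<beta>" "volterra_solution R Y B"
  shows "(\<lambda>t. V t ** R t ** Y t) absolutely_integrable_on {..0}"
  using assms integrand_absolutely_integrable[OF assms(1) _ volterra_solution_weight[OF assms(2)]]
  by (simp add: volterra_solution_def)

text \<open>\<open>Y x\<close> factors as \<open>\<Phi> x ** W x\<close> with \<open>W\<close> a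
  primitive plus \<open>P\<close>. The product rule yields the term with \<open>A\<close> from
  \<open>\<Phi>\<close> and the term with \<open>R\<close> from \<open>W\<close>, since
  \<open>\<Phi> x ** V x\<close> cancels.\<close>

lemma volterra_solution_ode:
  assumes R: "R \<in> weighted_L1 \<beta>" and Y: "volterra_solution R Y B"
  shows "matrix_ode_solution (\<lambda>x. A x + R x) {..0} Y"
  unfolding matrix_ode_solution_def
proof (intro conjI allI impI)
  let ?g = "\<lambda>t. V t ** R t ** Y t"
  define W where "W = (\<lambda>x. P + integral {..x} ?g)"
  note int = volterra_solution_integrand[OF R Y]
  have YW: "Y x = \<Phi> x ** W x" if "x \<le> 0" for x
    using Y that by (simp add: volterra_solution_def W_def matrix_mult.add_right)
  show "absolutely_continuous_fun_on {a..b} Y" if "{a..b} \<subseteq> {..0}" for a b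
  proof (rule absolutely_continuous_fun_on_cong)
    have "absolutely_continuous_fun_on {a..b} (\<lambda>x. integral {..x} ?g)"
      using absolutely_continuous_fun_on_integral_atMost[OF int] that by (rule absolutely_continuous_fun_on_subset)
    then have "absolutely_continuous_fun_on {a..b} W"
      using absolutely_continuous_fun_on_dominated[of "{a..b}" "\<lambda>x. integral {..x} ?g" "\<lambda>x. integral {..x} ?g" W 1]
      by (simp add: W_def)
    then show "absolutely_continuous_fun_on {a..b} (\<lambda>x. \<Phi> x ** W x)"
      by (intro absolutely_continuous_fun_on_matrix_mult AC)
    show "\<Phi> x ** W x = Y x" if "x \<in> {a..b}" for x
      using that \<open>{a..b} \<subseteq> {..0}\<close> YW[of x] by auto
  qed
  \<comment> \<open>The endpoint is a null set; at almost all other points of the half-line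
    two-sided derivatives are available.\<close>
  have "AE x in lebesgue. x \<noteq> (0::real)"
    unfolding eventually_ae_filter_negligible by (intro exI[of _ "{0}"]) auto
  then show "AE x in lebesgue. x \<in> {..0} \<longrightarrow> (Y has_vector_derivative (A x + R x) ** Y x) (at x within {..0})"
    using deriv AE_has_vector_derivative_integral_atMost[OF int]
  proof eventually_elim
    case (elim x)
    show ?case
    proof
      assume "x \<in> {..0}"
      then have x: "x < 0" using elim(1) by auto
      have "(W has_vector_derivative 0 + ?g x) (at x)"
        unfolding W_def using elim(3) x by (intro has_vector_derivative_add has_vector_derivative_const) auto
      then have "((\<lambda>x. \<Phi> x ** W x) has_vector_derivative \<Phi> x ** (0 + ?g x) + (A x ** \<Phi> x) ** W x) (at x)"
        by (intro matrix_mult.has_vector_derivative elim(2))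
      moreover have "\<Phi> x ** (0 + ?g x) + (A x ** \<Phi> x) ** W x = (A x + R x) ** Y x"
      proof -
        have "\<Phi> x ** ?g x = (\<Phi> x ** V x) ** R x ** Y x" by (simp add: matrix_mul_assoc)
        also have "\<dots> = R x ** Y x" using x by (simp add: inv)
        finally show ?thesis using YW[of x] x by (simp add: matrix_mult.add_left flip: matrix_mul_assoc)
      qed
      ultimately have "((\<lambda>x. \<Phi> x ** W x) has_vector_derivative (A x + R x) ** Y x) (at x)" by simp
      then have "(Y has_vector_derivative (A x + R x) ** Y x) (at x)"
        by (rule has_vector_derivative_transform_within_open[of _ _ _ "{..<0}"]) (use x YW in auto)
      then show "(Y has_vector_derivative (A x + R x) ** Y x) (at x within {..0})"
        by (rule has_vector_derivative_at_within)
    qed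
  qed
qed

text \<open>The change of the integrand is
  \<open>V t ** (R' t - R t) ** Y t + V t ** R' t ** D t\<close>. The first part is a forcing term
  controlled by data of \<open>Y\<close>; the second feeds Gronwall's inequality with density
  \<open>norm (R' t)\<close>. \<open>B'\<close> enters only the a priori bound \<open>B' + B\<close>
  there, so the final estimate is uniform for \<open>R'\<close> near \<open>R\<close>.\<close>

lemma volterra_solution_diff:
  assumes R: "R \<in> weighted_L1 \<beta>" and Y: "volterra_solution R Y B"
    and R': "R' \<in> weighted_L1 \<beta>" and Y': "volterra_solution R' Y' B'"
  shows "norm (Y' 0 - Y 0) \<le>
    2 * (C * (B + C') * weighted_L1_norm \<beta> (\<lambda>x. R' x - R x)) * exp (2 * C * weighted_L1_norm \<beta> R')"
proof -
  define \<rho> where "\<rho> = (\<lambda>t. if t \<le> 0 then norm (R' t) else 0)"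
  interpret nonneg_L1 \<rho> unfolding \<rho>_def using weighted_L1D(1)[OF R' \<beta>(2)] by (rule nonneg_L1_norm)
  let ?d = "weighted_L1_norm \<beta> (\<lambda>x. R' x - R x)"
  define D where "D = (\<lambda>t. Y' t - Y t)"
  define u where "u = (\<lambda>t. exp (- \<kappa> * t) * norm (D t))"
  have Ycont: "continuous_on {..0} Y" "continuous_on {..0} Y'" using Y Y' by (auto simp: volterra_solution_def)
  then have Dcont: "continuous_on {..0} D" unfolding D_def by (intro continuous_on_diff)
  have dR: "(\<lambda>x. R' x - R x) \<in> weighted_L1 \<beta>" by (rule weighted_L1_diff[OF R R'])
  have u0: "u t \<ge> 0" for t by (simp add: u_def)
  have u_le: "u t \<le> B' + B" if "t \<le> 0" for t
  proof -
    have "norm (D t) \<le> norm (Y' t - \<Phi> t ** P) + norm (Y t - \<Phi> t ** P)"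
      using norm_triangle_ineq4[of "Y' t - \<Phi> t ** P" "Y t - \<Phi> t ** P"] by (simp add: D_def)
    also have "\<dots> \<le> B' * exp (\<kappa> * t) + B * exp (\<kappa> * t)"
      using Y Y' that by (intro add_mono) (auto simp: volterra_solution_def)
    finally have "u t \<le> exp (- \<kappa> * t) * (B' * exp (\<kappa> * t) + B * exp (\<kappa> * t))"
      unfolding u_def by (intro mult_left_mono) auto
    also have "\<dots> = B' + B" by (simp add: exp_minus field_simps)
    finally show ?thesis .
  qed
  have B: "B \<ge> 0" using order_trans[OF norm_ge_zero, of "Y 0 - \<Phi> 0 ** P"] Y by (auto simp: volterra_solution_def)
  have d0: "?d \<ge> 0" unfolding weighted_L1D(3)[OF dR \<beta>(2)]
    by (rule integral_nonneg[OF weight_integrable[OF dR]]) auto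
  have a0: "0 \<le> C * (B + C') * ?d" using C B C'_nonneg d0 by auto
  have u_cont: "continuous_on {..0} u" unfolding u_def by (intro continuous_intros Dcont)
  note \<rho>u = mult_integrable_on[OF u_cont u0 u_le]
  have "u 0 \<le> 2 * (C * (B + C') * ?d) * exp (2 * C * m 0)"
  proof (rule gronwall_atMost[OF C a0 u_cont u0 u_le])
    fix y :: real assume y: "y \<le> 0"
    let ?g1 = "\<lambda>t. V t ** (R' t - R t) ** Y t" and ?g2 = "\<lambda>t. V t ** R' t ** D t"
    have i: "f integrable_on {..y}" if "f absolutely_integrable_on {..0}" for f :: "real \<Rightarrow> complex^'n^'n"
      using set_integrable_subset[OF that, of "{..y}"] y set_lebesgue_integral_eq_integral(1) by auto
    have int1: "?g1 absolutely_integrable_on {..0}"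
      by (rule integrand_absolutely_integrable[OF dR Ycont(1) volterra_solution_weight[OF Y]])
    note iY = volterra_solution_integrand[OF R Y] and iY' = volterra_solution_integrand[OF R' Y']
    have eq: "V t ** R' t ** Y' t - V t ** R t ** Y t = ?g1 t + ?g2 t" for t
      by (simp add: D_def matrix_mult.diff_left matrix_mult.diff_right)
    have int2: "?g2 integrable_on {..y}"
      using integrable_diff[OF integrable_diff[OF i[OF iY'] i[OF iY]] i[OF int1]] unfolding eq by simp
    have "D y = \<Phi> y ** integral {..y} (\<lambda>t. V t ** R' t ** Y' t - V t ** R t ** Y t)"
      using Y Y' y unfolding D_def volterra_solution_def
      by (simp add: integral_diff[OF i[OF iY'] i[OF iY]] matrix_mult.diff_right)
    also have "\<dots> = \<Phi> y ** integral {..y} ?g1 + \<Phi> y ** integral {..y} ?g2"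
      unfolding eq integral_add[OF i[OF int1] int2] by (rule matrix_mult.add_right)
    finally have "norm (D y) \<le> norm (\<Phi> y ** integral {..y} ?g1) + norm (\<Phi> y ** integral {..y} ?g2)"
      by (simp add: norm_triangle_ineq)
    also have "norm (\<Phi> y ** integral {..y} ?g2) \<le> integral {..y} (\<lambda>t. C * exp (\<kappa> * y) * (\<rho> t * u t))"
    proof (rule norm_matrix_mult_integral_le[OF int2])
      show "(\<lambda>t. C * exp (\<kappa> * y) * (\<rho> t * u t)) integrable_on {..y}"
        using y by (intro integrable_on_mult_right \<rho>u) auto
      fix t assume "t \<in> {..y}"
      then show "norm (\<Phi> y ** ?g2 t) \<le> C * exp (\<kappa> * y) * (\<rho> t * u t)"
        using kern_mult[of t y "R' t" "D t"] y by (simp add: \<rho>_def u_def)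
    qed
    finally have "u y \<le> exp (- \<kappa> * y) * (norm (\<Phi> y ** integral {..y} ?g1) + integral {..y} (\<lambda>t. C * exp (\<kappa> * y) * (\<rho> t * u t)))"
      unfolding fun_cong[OF u_def, of y] by (intro mult_left_mono) auto
    also have "\<dots> = exp (- \<kappa> * y) * norm (\<Phi> y ** integral {..y} ?g1) + C * integral {..y} (\<lambda>t. \<rho> t * u t)"
      unfolding integral_mult_right by (simp add: distrib_left exp_minus field_simps)
    also have "exp (- \<kappa> * y) * norm (\<Phi> y ** integral {..y} ?g1) \<le> C * (B + C') * ?d"
      by (rule integral_weight_le[OF dR Ycont(1) volterra_solution_weight[OF Y] y])
    finally show "u y \<le> C * (B + C') * ?d + C * integral {..y} (\<lambda>t. \<rho> t * u t)" by simp
  qed auto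
  moreover have "m 0 \<le> weighted_L1_norm \<beta> R'"
    unfolding m_def weighted_L1D(3)[OF R' \<beta>(2)]
  proof (rule integral_le[OF integrable_on weight_integrable[OF R']])
    show "\<rho> x \<le> norm (R' x) * exp (\<beta> * \<bar>x\<bar>)" if "x \<in> {..0}" for x
    proof -
      have "1 \<le> exp (\<beta> * \<bar>x\<bar>)" using \<beta>(2) by simp
      from mult_left_mono[OF this norm_ge_zero[of "R' x"]] show ?thesis using that by (simp add: \<rho>_def)
    qed
  qed auto
  then have "2 * (C * (B + C') * ?d) * exp (2 * C * m 0) \<le> 2 * (C * (B + C') * ?d) * exp (2 * C * weighted_L1_norm \<beta> R')"
    using a0 C by (intro mult_left_mono) auto
  ultimately show ?thesis by (simp add: u_def D_def)
qed

end

section \<open>Caratheodory solutions and invertibility of the fundamental matrix\<close>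

lemma fundamental_matrix_solutionD:
  assumes "fundamental_matrix_solution A \<Phi>"
  shows "absolutely_continuous_fun_on {a..b} \<Phi>"
    and "AE x in lebesgue. (\<Phi> has_vector_derivative A x ** \<Phi> x) (at x)"
    and "\<Phi> 0 = mat 1"
  using assms by (simp_all add: fundamental_matrix_solution_def matrix_ode_solution_def)

lemma matrix_ode_solution_atMostD:
  assumes "matrix_ode_solution M {..b} Y"
  shows "c \<le> b \<Longrightarrow> absolutely_continuous_fun_on {a..c} Y"
    and "AE x in lebesgue. x < b \<longrightarrow> (Y has_vector_derivative M x ** Y x) (at x)"
    and "continuous_on {..b} Y"
proof -
  show ac: "absolutely_continuous_fun_on {a..c} Y" if "c \<le> b" for a c
    using assms that by (simp add: matrix_ode_solution_def)
  have "AE x in lebesgue. x \<in> {..b} \<longrightarrow> (Y has_vector_derivative M x ** Y x) (at x within {..b})"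
    using assms by (simp add: matrix_ode_solution_def)
  then show "AE x in lebesgue. x < b \<longrightarrow> (Y has_vector_derivative M x ** Y x) (at x)"
  proof eventually_elim
    case (elim x)
    then show ?case using at_within_interior[of x "{..b}"] by auto
  qed
  show "continuous_on {..b} Y"
    by (intro continuous_on_atMostI absolutely_continuous_fun_on_imp_continuous_on ac is_interval_cc) simp
qed

text \<open>Lets a solution of the Volterra equation be replaced by its extensional
  restriction.\<close>

lemma matrix_ode_solution_cong:
  assumes eq: "\<And>x. x \<in> S \<Longrightarrow> Y x = Z x" and Y: "matrix_ode_solution M S Y"
  shows "matrix_ode_solution M S Z"
  unfolding matrix_ode_solution_def
proof (intro conjI allI impI)
  fix a b assume ab: "{a..b} \<subseteq> S"
  then have "absolutely_continuous_fun_on {a..b} Y" using Y by (simp add: matrix_ode_solution_def)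
  then show "absolutely_continuous_fun_on {a..b} Z"
    by (rule absolutely_continuous_fun_on_cong[rotated]) (use ab eq in auto)
next
  have "AE x in lebesgue. x \<in> S \<longrightarrow> (Y has_vector_derivative M x ** Y x) (at x within S)"
    using Y by (simp add: matrix_ode_solution_def)
  then show "AE x in lebesgue. x \<in> S \<longrightarrow> (Z has_vector_derivative M x ** Z x) (at x within S)"
  proof eventually_elim
    case (elim x)
    show ?case
    proof
      assume x: "x \<in> S"
      then have "(Y has_vector_derivative M x ** Z x) (at x within S)" using elim eq by simp
      then show "(Z has_vector_derivative M x ** Z x) (at x within S)"
        by (rule has_vector_derivative_transform[OF x, rotated]) (simp add: eq)
    qed
  qed
qed

text \<open>A vector annihilated by the solution at a negative time stays annihilated up to time \<open>0\<close>,
  where the solution is the identity.\<close>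

lemma fundamental_matrix_invertible:
  fixes A \<Phi> :: "real \<Rightarrow> complex^'n^'n"
  assumes A: "locally_integrable A" and \<Phi>: "fundamental_matrix_solution A \<Phi>" and x0: "x0 \<le> 0"
  shows "\<Phi> x0 ** matrix_inv (\<Phi> x0) = mat 1" "matrix_inv (\<Phi> x0) ** \<Phi> x0 = mat 1"
proof -
  note \<Phi>D = fundamental_matrix_solutionD[OF \<Phi>]
  have "invertible (\<Phi> x0)"
  proof (rule ccontr)
    assume "\<not> invertible (\<Phi> x0)"
    then obtain v where v: "\<Phi> x0 *v v = 0" "v \<noteq> 0"
      unfolding invertible_left_inverse matrix_left_invertible_ker by blast
    \<comment> \<open>All columns equal to \<open>v\<close>: the kernel vector becomes a square
      matrix, to which the matrix estimates apply.\<close>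
    define W :: "complex^'n^'n" where "W = (\<chi> i j. v $ i)"
    have "(\<Phi> x0 ** W) $ i $ j = (\<Phi> x0 *v v) $ i" for i j
      by (simp add: W_def matrix_matrix_mult_def matrix_vector_mult_def)
    then have W0: "\<Phi> x0 ** W = 0" using v by (simp add: vec_eq_iff)
    have W: "W \<noteq> 0" using v(2) by (auto simp: vec_eq_iff W_def)
    define \<rho> where "\<rho> = (\<lambda>t. if t \<in> {x0..0} then norm (A t) else 0)"
    have A': "(\<lambda>t. norm (A t)) absolutely_integrable_on {x0..0}"
      using A by (intro absolutely_integrable_norm[unfolded o_def]) (simp add: locally_integrable_def)
    interpret nonneg_L1 \<rho>
    proof
      show "\<rho> absolutely_integrable_on UNIV"
        unfolding \<rho>_def using absolutely_integrable_restrict_UNIV[of "{x0..0}" "\<lambda>t. norm (A t)"] A' by simp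
    qed (simp add: \<rho>_def)
    \<comment> \<open>The cut-off \<open>max t x0\<close> makes \<open>f\<close> vanish up to
      \<open>x0\<close>, so the problem on \<open>{x0..0}\<close> becomes one on the half-line with
      zero inhomogeneity.\<close>
    define f where "f = (\<lambda>t. \<Phi> (max t x0) ** W)"
    have \<Phi>_cont: "continuous_on {x0..0} \<Phi>"
      by (intro absolutely_continuous_fun_on_imp_continuous_on \<Phi>D is_interval_cc)
    have f_cont: "continuous_on {..0} f"
      unfolding f_def
      by (intro matrix_mult.continuous_on continuous_on_compose2[OF \<Phi>_cont] continuous_intros) (use x0 in auto)
    have f_eq: "f t = \<Phi> t ** W" if "x0 \<le> t" for t using that by (simp add: f_def max_def)
    have f_eq0: "f t = 0" if "t \<le> x0" for t using that W0 by (simp add: f_def max_def)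
    have "bounded (f ` {x0..0})"
      by (intro compact_imp_bounded compact_continuous_image continuous_on_subset[OF f_cont]) auto
    then obtain K where K: "\<And>t. t \<in> {x0..0} \<Longrightarrow> norm (f t) \<le> K"
      unfolding bounded_iff by blast
    have K0: "K \<ge> 0" using order_trans[OF norm_ge_zero K[of 0]] x0 by simp
    have f_le: "norm (f t) \<le> K" if "t \<le> 0" for t
      using K[of t] f_eq0[of t] K0 that by (cases "x0 \<le> t") auto
    have nf_cont: "continuous_on {..0} (\<lambda>t. norm (f t))" by (intro continuous_intros f_cont)
    note int = mult_integrable_on[OF nf_cont norm_ge_zero f_le]
    have "norm (f 0) \<le> 2 * 0 * exp (2 * 1 * m 0)"
    proof (rule gronwall_atMost[OF _ _ nf_cont norm_ge_zero f_le])
      fix y :: real assume y: "y \<le> 0"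
      show "norm (f y) \<le> 0 + 1 * integral {..y} (\<lambda>t. \<rho> t * norm (f t))"
      proof (cases "x0 \<le> y")
        case False
        then show ?thesis
          using integral_nonneg[OF int[of "{..y}"]] y nonneg by (simp add: f_eq0)
      next
        case True
        have "((\<lambda>t. (A t ** \<Phi> t) ** W) has_integral \<Phi> y ** W - \<Phi> x0 ** W) {x0..y}"
        proof (rule has_integral_AE_derivative[OF True])
          show "absolutely_continuous_fun_on {x0..y} (\<lambda>t. \<Phi> t ** W)"
          proof (rule absolutely_continuous_fun_on_dominated[OF \<Phi>D(1) \<Phi>D(1)])
            fix s t
            have "norm (\<Phi> t ** W - \<Phi> s ** W) \<le> norm (\<Phi> t - \<Phi> s) * norm W"
              unfolding matrix_mult.diff_left[symmetric] by (rule norm_matrix_mult_le)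
            also have "\<dots> \<le> (norm (\<Phi> t - \<Phi> s) + norm (\<Phi> t - \<Phi> s)) * norm W"
              by (intro mult_right_mono) auto
            finally show "norm (\<Phi> t ** W - \<Phi> s ** W) \<le> norm W * (norm (\<Phi> t - \<Phi> s) + norm (\<Phi> t - \<Phi> s))"
              by (simp add: mult.commute)
          qed
          show "AE t in lebesgue. x0 < t \<and> t < y \<longrightarrow>
              ((\<lambda>t. \<Phi> t ** W) has_vector_derivative (A t ** \<Phi> t) ** W) (at t)"
            using \<Phi>D(2)
          proof eventually_elim
            case (elim t)
            then show ?case
              using bounded_linear.has_vector_derivative[OF matrix_mult.bounded_linear_left] by blast
          qed
        qed
        then have hi: "((\<lambda>t. (A t ** \<Phi> t) ** W) has_integral f y) {x0..y}"
          using True W0 by (simp add: f_eq)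
        have sub: "(\<lambda>t. \<rho> t * norm (f t)) integrable_on {x0..y}" using y by (intro int) auto
        have "norm (f y) \<le> integral {x0..y} (\<lambda>t. \<rho> t * norm (f t))"
          unfolding integral_unique[OF hi, symmetric]
        proof (rule integral_norm_bound_integral[OF _ sub])
          fix t assume t: "t \<in> {x0..y}"
          have "norm (A t ** \<Phi> t ** W) \<le> norm (A t) * norm (\<Phi> t ** W)"
            unfolding matrix_mul_assoc[symmetric] by (rule norm_matrix_mult_le)
          then show "norm (A t ** \<Phi> t ** W) \<le> \<rho> t * norm (f t)"
            using t y by (simp add: \<rho>_def f_eq)
        qed (use hi in blast)
        also have "\<dots> \<le> integral {..y} (\<lambda>t. \<rho> t * norm (f t))"
          using y nonneg by (intro integral_subset_le int) auto
        finally show ?thesis by simp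
      qed
    qed auto
    then show False using W x0 by (simp add: f_eq \<Phi>D(3))
  qed
  \<comment> \<open>\<open>matrix_inv\<close> is defined by choice; once a two-sided inverse exists,
    the chosen matrix is one.\<close>
  then have "\<exists>B. \<Phi> x0 ** B = mat 1 \<and> B ** \<Phi> x0 = mat 1" by (auto simp: invertible_def)
  then have "\<Phi> x0 ** matrix_inv (\<Phi> x0) = mat 1 \<and> matrix_inv (\<Phi> x0) ** \<Phi> x0 = mat 1"
    unfolding matrix_inv_def by (rule someI_ex)
  then show "\<Phi> x0 ** matrix_inv (\<Phi> x0) = mat 1" "matrix_inv (\<Phi> x0) ** \<Phi> x0 = mat 1" by auto
qed

section \<open>Exponents\<close>

text \<open>Compactness covers the part of the half-line that the eventual bound leaves out, at the
  cost of another constant.\<close>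

lemma exp_bound_atMost:
  fixes f :: "real \<Rightarrow> 'a::real_normed_vector"
  assumes f: "continuous_on {..0} f" and ev: "\<forall>\<^sub>F x in at_bot. norm (f x) \<le> K * exp (\<gamma> * x)"
  obtains K' where "\<And>x. x \<le> 0 \<Longrightarrow> norm (f x) \<le> K' * exp (\<gamma> * x)"
proof -
  obtain b where b: "\<And>x. x \<le> b \<Longrightarrow> norm (f x) \<le> K * exp (\<gamma> * x)"
    using ev unfolding eventually_at_bot_linorder by blast
  have "bounded ((\<lambda>x. norm (f x) / exp (\<gamma> * x)) ` {b..0})"
    by (intro compact_imp_bounded compact_continuous_image continuous_intros continuous_on_subset[OF f]) auto
  then obtain K2 where K2: "\<And>x. x \<in> {b..0} \<Longrightarrow> norm (f x) / exp (\<gamma> * x) \<le> K2"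
    by (fastforce simp: bounded_iff)
  show thesis
  proof (rule that[of "max K K2"])
    fix x :: real assume x: "x \<le> 0"
    have "norm (f x) / exp (\<gamma> * x) \<le> max K K2"
    proof (cases "x \<le> b")
      case True
      then show ?thesis using b[OF True] by (simp add: divide_le_eq max_def mult_right_mono order_trans)
    next
      case False
      then show ?thesis using K2[of x] x by simp
    qed
    then show "norm (f x) \<le> max K K2 * exp (\<gamma> * x)" by (simp add: divide_le_eq)
  qed
qed

text \<open>\<open>ln B / x\<close> tends to 0 at minus infinity, so the constant costs an
  arbitrarily small loss in the exponent; the strict inequality provides room for it in the form of
  \<open>\<kappa>'\<close>.\<close>

lemma Liminf_elog_greaterI:
  fixes n :: "real \<Rightarrow> real"
  assumes n: "\<And>x. x \<le> 0 \<Longrightarrow> 0 \<le> n x" "\<And>x. x \<le> 0 \<Longrightarrow> n x \<le> B * exp (\<kappa> * x)" and k: "k < ereal \<kappa>"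
  shows "k < Liminf at_bot (\<lambda>x. elog (n x) / ereal x)"
proof -
  obtain \<kappa>' where \<kappa>': "k < ereal \<kappa>'" "\<kappa>' < \<kappa>" using ereal_dense2[OF k] by auto
  \<comment> \<open>Up to \<open>b\<close> the gain
    \<open>(\<kappa> - \<kappa>') * \<bar>x\<bar>\<close> exceeds \<open>\<bar>ln B\<bar>\<close>;
    the final 1 keeps \<open>b\<close> negative also when \<open>ln B = 0\<close>.\<close>
  define b where "b = - (\<bar>ln B\<bar> / (\<kappa> - \<kappa>')) - 1"
  have d: "\<kappa> - \<kappa>' > 0" using \<kappa>' by simp
  have "b < 0" using divide_nonneg_pos[OF abs_ge_zero[of "ln B"] d] by (simp add: b_def)
  moreover have "(\<kappa> - \<kappa>') * b = - \<bar>ln B\<bar> - (\<kappa> - \<kappa>')" using d by (simp add: b_def right_diff_distrib)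
  ultimately have b: "b < 0" "- \<bar>ln B\<bar> \<ge> (\<kappa> - \<kappa>') * b" using d by auto
  have "ereal \<kappa>' \<le> elog (n x) / ereal x" if x: "x \<le> b" for x
  proof (cases "n x = 0")
    case True
    \<comment> \<open>Minus infinity divided by a negative number is plus infinity, so zeros of
      \<open>n\<close> are harmless.\<close>
    then show ?thesis using x b by (simp add: elog_def divide_ereal_def)
  next
    case False
    have nx: "0 < n x" "n x \<le> B * exp (\<kappa> * x)" using n[of x] False x b by auto
    then have "0 < B * exp (\<kappa> * x)" by linarith
    then have B: "B > 0" by (simp add: zero_less_mult_iff)
    have "ln (n x) \<le> ln (B * exp (\<kappa> * x))" using nx by (intro ln_mono) auto
    also have "\<dots> = ln B + \<kappa> * x" using B by (simp add: ln_mult)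
    also have "\<dots> \<le> \<kappa>' * x"
    proof -
      have "(\<kappa> - \<kappa>') * x \<le> (\<kappa> - \<kappa>') * b" using x \<kappa>' by (intro mult_left_mono) auto
      then show ?thesis using b(2) by (simp add: algebra_simps)
    qed
    finally have "\<kappa>' \<le> ln (n x) / x" using x b by (simp add: neg_le_divide_eq)
    then show ?thesis using False x b by (simp add: elog_def)
  qed
  then have "ereal \<kappa>' \<le> Liminf at_bot (\<lambda>x. elog (n x) / ereal x)"
    by (intro Liminf_bounded eventually_at_bot_linorderI[of b])
  then show ?thesis using \<kappa>'(1) by (rule less_le_trans[rotated])
qed

text \<open>A real number fits strictly between \<open>k\<close> and the lower limit, and it serves
  as the rate. Division by the negative \<open>x\<close> reverses the inequality, so a large
  quotient means a small \<open>n x\<close>.\<close>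

lemma Liminf_elog_greaterD:
  fixes n :: "real \<Rightarrow> real"
  assumes n: "\<And>x. 0 \<le> n x" and k: "k < Liminf at_bot (\<lambda>x. elog (n x) / ereal x)"
  obtains \<gamma> where "k < ereal \<gamma>" "\<forall>\<^sub>F x in at_bot. n x \<le> exp (\<gamma> * x)"
proof -
  obtain \<gamma> where \<gamma>: "k < ereal \<gamma>" "ereal \<gamma> < Liminf at_bot (\<lambda>x. elog (n x) / ereal x)"
    using ereal_dense2[OF k] by auto
  have "\<forall>\<^sub>F x in at_bot. n x \<le> exp (\<gamma> * x)"
    using less_LiminfD[OF \<gamma>(2)] eventually_le_at_bot[of "-1"]
  proof eventually_elim
    case (elim x)
    show ?case
    proof (cases "n x = 0")
      case False
      then have "\<gamma> < ln (n x) / x" using elim by (simp add: elog_def)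
      then have "ln (n x) < \<gamma> * x" using elim(2) by (simp add: neg_less_divide_eq)
      then have "exp (ln (n x)) < exp (\<gamma> * x)" by simp
      then show ?thesis using False n[of x] by simp
    qed simp
  qed
  then show thesis using that \<gamma>(1) by blast
qed

lemma less_lower_lyapunov_minusD:
  assumes "ereal \<mu> < lower_lyapunov_minus \<Phi> P"
  shows "\<forall>\<^sub>F x in at_bot. norm (\<Phi> x ** P) \<le> 1 * exp (\<mu> * x)"
proof -
  have "Limsup at_bot (\<lambda>x. elog (norm (\<Phi> x ** P)) / ereal \<bar>x\<bar>) < ereal (- \<mu>)"
    using iffD1[OF ereal_less_uminus_reorder assms[unfolded lower_lyapunov_minus_def]] by simp
  from Limsup_lessD[OF this] show ?thesis
    using eventually_le_at_bot[of "-1"]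
  proof eventually_elim
    case (elim x)
    show ?case
    proof (cases "norm (\<Phi> x ** P) = 0")
      case False
      then have "ln (norm (\<Phi> x ** P)) / \<bar>x\<bar> < - \<mu>" using elim by (simp add: elog_def)
      then have ln: "ln (norm (\<Phi> x ** P)) < \<mu> * x" using elim(2) by (simp add: neg_less_divide_eq)
      have "norm (\<Phi> x ** P) = exp (ln (norm (\<Phi> x ** P)))" using False by simp
      also have "\<dots> \<le> exp (\<mu> * x)" using ln by simp
      finally show ?thesis by simp
    qed simp
  qed
qed

text \<open>For finite exponents half of the slack goes to each side. Infinite exponents are treated
  separately; in every case that survives, the choice has
  \<open>\<kappa> - \<mu> = \<beta>\<close>.\<close>

lemma ereal_diff_less_obtain:
  fixes k l :: ereal
  assumes "k - l < ereal \<beta>"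
  obtains \<kappa> \<mu> where "k < ereal \<kappa>" "ereal \<mu> < l" "\<kappa> - \<mu> \<le> \<beta>"
proof (cases k)
  case (real k')
  show thesis
  proof (cases l)
    case (real l')
    define d where "d = (\<beta> - (k' - l')) / 2"
    have "d > 0" using assms real \<open>k = ereal k'\<close> by (simp add: d_def)
    then show thesis using that[of "k' + d" "l' - d"] real \<open>k = ereal k'\<close> by (simp add: d_def)
  next
    case PInf
    then show thesis using that[of "k' + 1" "k' + 1 - \<beta>"] real by simp
  qed (use assms real in simp)
next
  case MInf
  show thesis
  proof (cases l)
    case (real l')
    then show thesis using that[of "l' - 1 + \<beta>" "l' - 1"] MInf by simp
  next
    case PInf
    then show thesis using that[of \<beta> 0] MInf by simp
  qed (use assms MInf in simp)
qed (use assms in simp)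

section \<open>Jost solutions\<close>

locale dichotomy =
  fixes A \<Phi> :: "real \<Rightarrow> complex^'n^'n" and Q :: "complex^'n^'n"
  assumes A: "locally_integrable A" and \<Phi>: "fundamental_matrix_solution A \<Phi>"
    and Q: "exponential_dichotomy \<Phi> Q" "Q \<noteq> mat 1"
begin

abbreviation P where "P \<equiv> mat 1 - Q"
abbreviation V where "V x \<equiv> matrix_inv (\<Phi> x)"
abbreviation k where "k \<equiv> upper_bohl_minus \<Phi> P"

text \<open>The admissible rates as real numbers. The set is upward closed, so every rate strictly
  above the infimum can be used although the infimum itself may fail to belong.\<close>

definition bohl :: "real set" where
  "bohl = {\<kappa>. \<exists>C. \<forall>x x'. x' \<le> x \<and> x \<le> 0 \<longrightarrow> norm (\<Phi> x ** P ** V x') \<le> C * exp (\<kappa> * (x - x'))}"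

lemma k_eq: "k = Inf (ereal ` bohl)"
  by (simp add: upper_bohl_minus_def bohl_def)

lemmas inv = fundamental_matrix_invertible[OF A \<Phi>]

lemma PP: "P ** P = P"
  using Q(1) by (simp add: exponential_dichotomy_def matrix_projection_def matrix_mult.diff_left matrix_mult.diff_right)

lemma P_neq_0: "P \<noteq> 0"
  using Q(2) by simp

lemma \<Phi>0: "\<Phi> 0 = mat 1"
  by (rule fundamental_matrix_solutionD[OF \<Phi>])

lemma V0: "V 0 = mat 1"
  using inv(1)[of 0] by (simp add: \<Phi>0)

lemma bohl_mono:
  assumes "\<kappa> \<in> bohl" "\<kappa> \<le> \<kappa>'"
  shows "\<kappa>' \<in> bohl"
proof -
  obtain C where C: "\<And>x x'. x' \<le> x \<Longrightarrow> x \<le> 0 \<Longrightarrow> norm (\<Phi> x ** P ** V x') \<le> C * exp (\<kappa> * (x - x'))"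
    using assms(1) by (auto simp: bohl_def)
  have "norm (\<Phi> x ** P ** V x') \<le> \<bar>C\<bar> * exp (\<kappa>' * (x - x'))" if "x' \<le> x" "x \<le> 0" for x x'
  proof -
    have "C * exp (\<kappa> * (x - x')) \<le> \<bar>C\<bar> * exp (\<kappa>' * (x - x'))"
      using assms(2) that by (intro mult_mono) (auto intro: mult_right_mono)
    then show ?thesis using C[OF that] by linarith
  qed
  then show ?thesis unfolding bohl_def by blast
qed

lemma bohl_greater: "k < ereal \<kappa> \<Longrightarrow> \<kappa> \<in> bohl"
  unfolding k_eq Inf_less_iff using bohl_mono by (auto dest: less_imp_le)

lemma bohl_less:
  assumes "k < ereal \<gamma>" obtains \<kappa> where "\<kappa> \<in> bohl" "\<kappa> < \<gamma>"
  using assms that unfolding k_eq Inf_less_iff by auto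

text \<open>The growth rate of the range of \<open>P\<close> can be no smaller than any decay rate of \<open>\<Phi> P\<close>, because
  \<open>P = (P \<Phi>(x)\<^sup>-\<^sup>1) (\<Phi>(x) P)\<close> does not vanish.\<close>

lemma decay_le_bohl:
  assumes "\<kappa> \<in> bohl" and K: "\<And>x. x \<le> 0 \<Longrightarrow> norm (\<Phi> x ** P) \<le> K * exp (\<mu> * x)"
  shows "\<mu> \<le> \<kappa>"
proof (rule ccontr)
  assume "\<not> \<mu> \<le> \<kappa>"
  then have \<mu>: "\<mu> - \<kappa> > 0" by simp
  obtain C where C: "\<And>x x'. x' \<le> x \<Longrightarrow> x \<le> 0 \<Longrightarrow> norm (\<Phi> x ** P ** V x') \<le> C * exp (\<kappa> * (x - x'))"
    using assms(1) by (auto simp: bohl_def)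
  have le: "norm P \<le> C * K * exp ((\<mu> - \<kappa>) * x)" if x: "x \<le> 0" for x
  proof -
    have "P = P ** (V x ** \<Phi> x) ** P" using inv(2)[OF x] by (simp add: PP)
    also have "\<dots> = (\<Phi> 0 ** P ** V x) ** (\<Phi> x ** P)" by (simp add: \<Phi>0 matrix_mul_assoc)
    also have "norm \<dots> \<le> norm (\<Phi> 0 ** P ** V x) * norm (\<Phi> x ** P)" by (rule norm_matrix_mult_le)
    also have "\<dots> \<le> (C * exp (\<kappa> * (0 - x))) * (K * exp (\<mu> * x))"
      using C[OF x order_refl] K[OF x] order_trans[OF norm_ge_zero C[OF x order_refl]]
      by (intro mult_mono) auto
    also have "\<dots> = C * K * exp ((\<mu> - \<kappa>) * x)" by (simp add: mult_exp_exp algebra_simps)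
    finally show ?thesis .
  qed
  have "((\<lambda>x. exp ((\<mu> - \<kappa>) * x)) \<longlongrightarrow> 0) at_bot"
    using \<mu> by (intro filterlim_compose[OF exp_at_bot] filterlim_tendsto_pos_mult_at_bot[OF tendsto_const _ filterlim_ident]) auto
  then have "((\<lambda>x. C * K * exp ((\<mu> - \<kappa>) * x)) \<longlongrightarrow> C * K * 0) at_bot" by (intro tendsto_intros)
  then have "norm P \<le> C * K * 0"
    by (rule tendsto_lowerbound) (use eventually_mono[OF eventually_le_at_bot[of 0] le] in auto)
  then show False using P_neq_0 by simp
qed

lemma fundamental_half_line:
  assumes "\<kappa> \<in> bohl"
  obtains C where "fundamental_half_line A \<Phi> V C \<kappa>"
proof -
  obtain q p Cq Cp where qp: "q > 0" "p > 0" "Cq \<ge> 1" "Cp \<ge> 1"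
    "\<And>x x'. x' \<le> x \<Longrightarrow> norm (\<Phi> x ** Q ** V x') \<le> Cq * exp (- q * (x - x'))"
    "\<And>x x'. x \<le> x' \<Longrightarrow> norm (\<Phi> x ** P ** V x') \<le> Cp * exp (p * (x - x'))"
    using Q(1) unfolding exponential_dichotomy_def by blast
  \<comment> \<open>The dichotomy bound at \<open>x' = 0\<close> is a decay rate of
    \<open>\<Phi> x ** P\<close>, so the positivity of \<open>p\<close> passes to
    \<open>\<kappa>\<close>.\<close>
  have "p \<le> \<kappa>"
  proof (rule decay_le_bohl[OF assms])
    show "norm (\<Phi> x ** P) \<le> Cp * exp (p * x)" if "x \<le> 0" for x
      using qp(6)[OF that] by (simp add: V0)
  qed
  then have \<kappa>: "\<kappa> > 0" using qp by simp
  obtain C where C: "\<And>x x'. x' \<le> x \<Longrightarrow> x \<le> 0 \<Longrightarrow> norm (\<Phi> x ** P ** V x') \<le> C * exp (\<kappa> * (x - x'))"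
    using assms by (auto simp: bohl_def)
  \<comment> \<open>The Bohl constant \<open>C\<close> has no prescribed sign, hence its absolute
    value; \<open>Cq \<ge> 1\<close> makes the sum positive.\<close>
  have "fundamental_half_line A \<Phi> V (\<bar>C\<bar> + Cq) \<kappa>"
  proof
    fix x t :: real assume tx: "t \<le> x" "x \<le> 0"
    have "\<Phi> x ** V t = \<Phi> x ** P ** V t + \<Phi> x ** Q ** V t"
      by (simp add: matrix_mult.diff_left matrix_mult.diff_right)
    also have "norm \<dots> \<le> C * exp (\<kappa> * (x - t)) + Cq * exp (- q * (x - t))"
      by (intro norm_triangle_mono C qp tx)
    also have "\<dots> \<le> \<bar>C\<bar> * exp (\<kappa> * (x - t)) + Cq * exp (\<kappa> * (x - t))"
    proof (intro add_mono mult_right_mono mult_left_mono)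
      have "- q * (x - t) \<le> \<kappa> * (x - t)" using tx \<kappa> qp(1) by (intro mult_right_mono) auto
      then show "exp (- q * (x - t)) \<le> exp (\<kappa> * (x - t))" by simp
    qed (use qp in auto)
    finally show "norm (\<Phi> x ** V t) \<le> (\<bar>C\<bar> + Cq) * exp (\<kappa> * (x - t))" by (simp add: distrib_right)
  qed (use fundamental_matrix_solutionD[OF \<Phi>] inv qp in auto)
  then show thesis by (rule that)
qed

lemma half_line_jost_exists:
  assumes \<beta>: "k - lower_lyapunov_minus \<Phi> P < ereal \<beta>"
  obtains C \<kappa> C' \<mu> where "half_line_jost A \<Phi> V C \<kappa> P C' \<mu> \<beta>" "k < ereal \<kappa>"
proof -
  obtain \<kappa> \<mu> where \<kappa>: "k < ereal \<kappa>" and \<mu>: "ereal \<mu> < lower_lyapunov_minus \<Phi> P" and le: "\<kappa> - \<mu> \<le> \<beta>"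
    by (rule ereal_diff_less_obtain[OF \<beta>])
  have "\<kappa> \<in> bohl" using \<kappa> by (rule bohl_greater)
  then obtain C where C: "fundamental_half_line A \<Phi> V C \<kappa>" by (rule fundamental_half_line)
  interpret fundamental_half_line A \<Phi> V C \<kappa> by (rule C)
  have "continuous_on {..0} (\<lambda>x. \<Phi> x ** P)"
    by (intro matrix_mult.continuous_on cont continuous_on_const)
  then obtain C' where C': "\<And>x. x \<le> 0 \<Longrightarrow> norm (\<Phi> x ** P) \<le> C' * exp (\<mu> * x)"
    by (rule exp_bound_atMost[OF _ less_lower_lyapunov_minusD[OF \<mu>]]) blast
  \<comment> \<open>Together with \<open>\<kappa> - \<mu> \<le> \<beta>\<close> this yields
    \<open>\<beta> \<ge> 0\<close>.\<close>
  have "\<mu> \<le> \<kappa>" by (rule decay_le_bohl[OF \<open>\<kappa> \<in> bohl\<close> C'])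
  then have "half_line_jost A \<Phi> V C \<kappa> P C' \<mu> \<beta>"
    by unfold_locales (use C' le in auto)
  then show thesis using \<kappa> by (rule that)
qed

text \<open>Both solutions approach \<open>\<Phi> x ** P\<close>, so their difference solves the
  perturbed equation and decays at the smaller of the two rates. By \<open>bohl_less\<close> some
  admissible \<open>\<kappa>\<close> lies below that rate, and \<open>decaying_solution_eq_0\<close>
  applies.\<close>

lemma jost_solution_unique:
  assumes R: "R absolutely_integrable_on {..0}"
    and Y: "jost_solution_minus A \<Phi> Q R Y" and Z: "jost_solution_minus A \<Phi> Q R Z"
  shows "Y = Z"
proof -
  obtain y where y: "k < ereal y" "\<forall>\<^sub>F x in at_bot. norm (Y x - \<Phi> x ** P) \<le> exp (y * x)"
    by (rule Liminf_elog_greaterD[of "\<lambda>x. norm (Y x - \<Phi> x ** P)" k])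
      (use Y in \<open>auto simp: jost_solution_minus_def\<close>)
  obtain z where z: "k < ereal z" "\<forall>\<^sub>F x in at_bot. norm (Z x - \<Phi> x ** P) \<le> exp (z * x)"
    by (rule Liminf_elog_greaterD[of "\<lambda>x. norm (Z x - \<Phi> x ** P)" k])
      (use Z in \<open>auto simp: jost_solution_minus_def\<close>)
  define \<gamma> where "\<gamma> = min y z"
  have "k < ereal \<gamma>" using y(1) z(1) by (simp add: \<gamma>_def min_def)
  then obtain \<kappa> where \<kappa>: "\<kappa> \<in> bohl" "\<kappa> < \<gamma>" by (rule bohl_less)
  obtain C where C: "fundamental_half_line A \<Phi> V C \<kappa>" using \<kappa>(1) by (rule fundamental_half_line)
  interpret fundamental_half_line A \<Phi> V C \<kappa> by (rule C)
  define D where "D = (\<lambda>x. Y x - Z x)"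
  have YZ: "matrix_ode_solution (\<lambda>x. A x + R x) {..0} Y" "matrix_ode_solution (\<lambda>x. A x + R x) {..0} Z"
    using Y Z by (auto simp: jost_solution_minus_def)
  note Y' = matrix_ode_solution_atMostD[OF YZ(1)] and Z' = matrix_ode_solution_atMostD[OF YZ(2)]
  have D_cont: "continuous_on {..0} D" unfolding D_def by (intro continuous_on_diff Y' Z')
  have "\<forall>\<^sub>F x in at_bot. norm (D x) \<le> 2 * exp (\<gamma> * x)"
    using y(2) z(2) eventually_le_at_bot[of 0]
  proof eventually_elim
    case (elim x)
    have "norm (D x) \<le> norm (Y x - \<Phi> x ** P) + norm (Z x - \<Phi> x ** P)"
      using norm_triangle_ineq4[of "Y x - \<Phi> x ** P" "Z x - \<Phi> x ** P"] by (simp add: D_def)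
    also have "\<dots> \<le> exp (y * x) + exp (z * x)" using elim by simp
    \<comment> \<open>For \<open>x \<le> 0\<close> the smaller rate gives the larger
      exponential.\<close>
    also have "\<dots> \<le> exp (\<gamma> * x) + exp (\<gamma> * x)"
      using elim(3) by (intro add_mono) (auto simp: \<gamma>_def intro!: mult_right_mono_neg)
    finally show ?case by simp
  qed
  then obtain K where K: "\<And>x. x \<le> 0 \<Longrightarrow> norm (D x) \<le> K * exp (\<gamma> * x)"
    using exp_bound_atMost[OF D_cont] by metis
  have "D x = 0" if "x \<le> 0" for x
  proof (rule decaying_solution_eq_0[OF _ _ R K \<kappa>(2) that])
    show "absolutely_continuous_fun_on {a..b} D" if "b \<le> 0" for a b
    proof (rule absolutely_continuous_fun_on_dominated[OF Y'(1)[OF that] Z'(1)[OF that]])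
      show "norm (D t - D s) \<le> 1 * (norm (Y t - Y s) + norm (Z t - Z s))" for s t
        using norm_triangle_ineq4[of "Y t - Y s" "Z t - Z s"] by (simp add: D_def algebra_simps)
    qed
    show "AE t in lebesgue. t < 0 \<longrightarrow> (D has_vector_derivative (A t + R t) ** D t) (at t)"
      using Y'(2) Z'(2)
    proof eventually_elim
      case (elim t)
      then show ?case
        unfolding D_def matrix_mult.diff_right by (auto intro: has_vector_derivative_diff)
    qed
  qed
  then have "Y x = Z x" if "x \<in> {..0}" for x using that by (simp add: D_def)
  then show ?thesis
    using Y Z by (intro extensionalityI[of Y "{..0}" Z]) (auto simp: jost_solution_minus_def)
qed

end

theorem theorem3p8:
  fixes A \<Phi> :: "real \<Rightarrow> complex^'d^'d" and Q :: "complex^'d^'d" and \<beta> :: real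
  assumes "locally_integrable A"
    and "fundamental_matrix_solution A \<Phi>"
    and "propagator_exponentially_bounded \<Phi>"
    and "exponential_dichotomy \<Phi> Q"
    and "Q \<noteq> mat 1"
    and "ereal \<beta> > upper_bohl_minus \<Phi> (mat 1 - Q) - lower_lyapunov_minus \<Phi> (mat 1 - Q)"
  shows "(\<forall>R. locally_integrable R \<and> R \<in> weighted_L1 \<beta> \<longrightarrow>
            (\<exists>!Y. jost_solution_minus A \<Phi> Q R Y)) \<and>
         weighted_L1_continuous \<beta> (\<lambda>R. the_jost_minus A \<Phi> Q R 0)"
proof -
  interpret dichotomy A \<Phi> Q using assms by unfold_locales
  \<comment> \<open>These constants do not depend on \<open>R\<close>, so a single interpretation
    serves all perturbations compared in the continuity proof.\<close>
  obtain C \<kappa> C' \<mu> where J: "half_line_jost A \<Phi> V C \<kappa> P C' \<mu> \<beta>" and \<kappa>: "k < ereal \<kappa>"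
    using assms(6) by (rule half_line_jost_exists)
  interpret half_line_jost A \<Phi> V C \<kappa> P C' \<mu> \<beta> by (rule J)
  have jost: "jost_solution_minus A \<Phi> Q R (restrict Y {..0})"
    if R: "R \<in> weighted_L1 \<beta>" and Y: "volterra_solution R Y B" for R Y B
    unfolding jost_solution_minus_def
  proof (intro conjI)
    show "matrix_ode_solution (\<lambda>x. A x + R x) {..0} (restrict Y {..0})"
      by (rule matrix_ode_solution_cong[OF _ volterra_solution_ode[OF R Y]]) simp
    show "k < Liminf at_bot (\<lambda>x. elog (norm (restrict Y {..0} x - \<Phi> x ** P)) / ereal x)"
      by (rule Liminf_elog_greaterI[of _ B \<kappa>]) (use Y \<kappa> in \<open>auto simp: volterra_solution_def\<close>)
  qed simp
  have unique: "\<exists>!Y. jost_solution_minus A \<Phi> Q R Y" if R: "R \<in> weighted_L1 \<beta>" for R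
  proof -
    obtain Y B where "volterra_solution R Y B" using R by (rule volterra_solution_exists)
    then show ?thesis
      using jost[OF R] jost_solution_unique[OF weighted_L1D(1)[OF R \<beta>(2)]] by blast
  qed
  have the_jost: "the_jost_minus A \<Phi> Q R 0 = Y 0"
    if "R \<in> weighted_L1 \<beta>" "volterra_solution R Y B" for R Y B
  proof -
    have "the_jost_minus A \<Phi> Q R = restrict Y {..0}"
      unfolding the_jost_minus_def by (rule the1_equality[OF unique[OF that(1)]]) (rule jost[OF that])
    then show ?thesis by simp
  qed
  have "weighted_L1_continuous \<beta> (\<lambda>R. the_jost_minus A \<Phi> Q R 0)"
    unfolding weighted_L1_continuous_def
  proof (intro ballI allI impI)
    fix R :: "real \<Rightarrow> complex^'d^'d" and e :: real assume R: "R \<in> weighted_L1 \<beta>" and e: "e > 0"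
    obtain Y B where Y: "volterra_solution R Y B" using R by (rule volterra_solution_exists)
    \<comment> \<open>The sign of \<open>B + C'\<close> is read off from the weighted bound at
      \<open>t = 0\<close>.\<close>
    have "0 \<le> (B + C') * exp (\<beta> * \<bar>0\<bar>)"
      by (rule order_trans[OF _ volterra_solution_weight[OF Y order_refl]]) simp
    then have BC: "B + C' \<ge> 0" by simp
    \<comment> \<open>The Gronwall factor contains the norm of \<open>R'\<close>. Since
      \<open>\<delta> \<le> 1\<close>, it is at most the norm of \<open>R\<close> plus 1, so
      \<open>M\<close> depends on data of \<open>R\<close> alone.\<close>
    define M where "M = 2 * (C * (B + C')) * exp (2 * C * (weighted_L1_norm \<beta> R + 1))"
    have M: "M \<ge> 0" using C BC by (simp add: M_def)
    define \<delta> where "\<delta> = min 1 (e / (M + 1))"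
    have \<delta>: "\<delta> > 0" using e M by (simp add: \<delta>_def)
    show "\<exists>\<delta>>0. \<forall>R'\<in>weighted_L1 \<beta>. weighted_L1_norm \<beta> (\<lambda>x. R' x - R x) < \<delta> \<longrightarrow>
        norm (the_jost_minus A \<Phi> Q R' 0 - the_jost_minus A \<Phi> Q R 0) < e"
    proof (intro exI[of _ \<delta>] conjI ballI impI \<delta>)
      fix R' assume R': "R' \<in> weighted_L1 \<beta>" and lt: "weighted_L1_norm \<beta> (\<lambda>x. R' x - R x) < \<delta>"
      let ?d = "weighted_L1_norm \<beta> (\<lambda>x. R' x - R x)"
      obtain Y' B' where Y': "volterra_solution R' Y' B'" using R' by (rule volterra_solution_exists)
      note dR = weighted_L1_diff[OF R R']
      have d0: "?d \<ge> 0" unfolding weighted_L1D(3)[OF dR \<beta>(2)]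
        by (rule integral_nonneg[OF weight_integrable[OF dR]]) auto
      have "weighted_L1_norm \<beta> R' \<le> integral {..0} (\<lambda>t. norm (R t) * exp (\<beta> * \<bar>t\<bar>) + norm (R' t - R t) * exp (\<beta> * \<bar>t\<bar>))"
        unfolding weighted_L1D(3)[OF R' \<beta>(2)]
      proof (rule integral_le)
        fix t :: real
        have "norm (R' t) \<le> norm (R t) + norm (R' t - R t)"
          using norm_triangle_ineq[of "R t" "R' t - R t"] by simp
        then show "norm (R' t) * exp (\<beta> * \<bar>t\<bar>) \<le> norm (R t) * exp (\<beta> * \<bar>t\<bar>) + norm (R' t - R t) * exp (\<beta> * \<bar>t\<bar>)"
          unfolding distrib_right[symmetric] by (intro mult_right_mono) auto
      qed (auto intro!: integrable_add weight_integrable R R' dR)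
      also have "\<dots> = weighted_L1_norm \<beta> R + ?d"
        unfolding weighted_L1D(3)[OF R \<beta>(2)] weighted_L1D(3)[OF dR \<beta>(2)]
        by (intro integral_add weight_integrable R dR) auto
      finally have R'_le: "weighted_L1_norm \<beta> R' \<le> weighted_L1_norm \<beta> R + 1" using lt by (simp add: \<delta>_def)
      have "norm (Y' 0 - Y 0) \<le> 2 * (C * (B + C') * ?d) * exp (2 * C * weighted_L1_norm \<beta> R')"
        by (rule volterra_solution_diff[OF R Y R' Y'])
      also have "\<dots> \<le> 2 * (C * (B + C') * ?d) * exp (2 * C * (weighted_L1_norm \<beta> R + 1))"
        using C BC d0 R'_le by (intro mult_left_mono) auto
      also have "\<dots> = M * ?d" by (simp add: M_def)
      also have "\<dots> \<le> M * \<delta>" using M lt by (intro mult_left_mono) auto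
      also have "\<dots> \<le> M * (e / (M + 1))" using M by (intro mult_left_mono) (auto simp: \<delta>_def)
      also have "\<dots> < e" using M e by (simp add: field_simps)
      finally show "norm (the_jost_minus A \<Phi> Q R' 0 - the_jost_minus A \<Phi> Q R 0) < e"
        by (simp add: the_jost[OF R Y] the_jost[OF R' Y'])
    qed
  qed
  then show ?thesis using unique by blast
qed

end
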